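(* Let $\vec n=(n_1,\ldots,n_p)$ and $\vec m=(m_1,\ldots,m_q)$ be multi-indices with $|\vec m|=|\vec n|+1$, let $\pi_s,\pi_{\mathfrak s}$ be permutations of $\{1,\ldots,p\}$ and $\pi_t,\pi_{\mathfrak t}$ permutations of $\{1,\ldots,q\}$, and use the mixed Piñeiro forms $A$ and $B$ in their contour normalization (see context). Consider the recurrence relation $$xB_{\vec n,\vec m}(x)=\sum_{j=1}^q b^j_{\vec n,\vec m}B_{\vec n+\vec{\mathfrak s}_j,\vec m+\vec t_j}(x)+b^0_{\vec n,\vec m}B_{\vec n,\vec m}(x)+\sum_{i=1}^p b^{-i}_{\vec n,\vec m}B_{\vec n-\vec s_i,\vec m-\vec{\mathfrak t}_i}(x),$$ whose coefficients are $$b^{j}_{\vec n,\vec m}=\frac{\int_0^1 xA_{\vec n+\vec{\mathfrak s}_{j+1},\vec m+\vec t_{j-1}}B_{\vec n,\vec m}\,\mathrm dx}{\int_0^1 A_{\vec n+\vec{\mathfrak s}_{j+1},\vec m+\vec t_{j-1}}B_{\vec n+\vec{\mathfrak s}_j,\vec m+\vec t_j}\,\mathrm dx},\quad b^{0}_{\vec n,\vec m}=\frac{\int_0^1 xA_{\vec n+\vec{\mathfrak s}_1,\vec m-\vec{\mathfrak t}_1}B_{\vec n,\vec m}\,\mathrm dx}{\int_0^1 A_{\vec n+\vec{\mathfrak s}_1,\vec m-\vec{\mathfrak t}_1}B_{\vec n,\vec m}\,\mathrm dx},\quad b^{-i}_{\vec n,\vec m}=\frac{\int_0^1 xA_{\vec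 n-\vec s_{i-1},\vec m-\vec{\mathfrak t}_{i+1}}B_{\vec n,\vec m}\,\mathrm dx}{\int_0^1 A_{\vec n-\vec s_{i-1},\vec m-\vec{\mathfrak t}_{i+1}}B_{\vec n-\vec s_i,\vec m-\vec{\mathfrak t}_i}\,\mathrm dx}.$$ These recurrence coefficients are, for $j\in\{1,\ldots,q\}$ and $i\in\{1,\ldots,p\}$, $$b^j_{\vec n,\vec m}=\prod_{a=1}^p\frac{(\alpha_a+\beta_{\pi_t(j)}+m_{\pi_t(j)}+1)_{(\vec n+\vec{\mathfrak s}_{j+1})_a}}{(\alpha_a+\beta_{\pi_t(j)}+m_{\pi_t(j)}+1)_{(\vec n+\vec{\mathfrak s}_{j})_a}}\sum_{k=j}^q\prod_{a=1}^p\frac{(\alpha_a+\beta_{\pi_t(k)}+m_{\pi_t(k)})_{n_a}}{(\alpha_a+\beta_{\pi_t(k)}+m_{\pi_t(k)}+1)_{(\vec n+\vec{\mathfrak s}_{j+1})_a}}\cdot\frac{\prod_{h=1}^q\bigl(\beta_{\pi_t(h)}-\beta_{\pi_t(k)}-m_{\pi_t(k)}\bigr)}{\prod_{h=j,\,h\ne k}^q\bigl(\beta_{\pi_t(h)}-\beta_{\pi_t(k)}-m_{\pi_t(k)}+m_{\pi_t(h)}\bigr)},$$ $$\begin{aligned}b^0_{\vec n,\vec m}={}&\prod_{h=1}^q\frac{\alpha_{\pi_{\mathfrak s}(1)}+\beta_h+n_{\pi_{\mathfrak s}(1)}+1}{\alpha_{\pi_{\mathfrak s}(1)}+\beta_h+n_{\pi_{\mathfrak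 s}(1)}+m_h+1}\prod_{a=1}^p\frac{\alpha_a-\alpha_{\pi_{\mathfrak s}(1)}-n_{\pi_{\mathfrak s}(1)}-1}{\alpha_a-\alpha_{\pi_{\mathfrak s}(1)}-n_{\pi_{\mathfrak s}(1)}+n_a-1}\\&+\sum_{k=1}^p\frac{\alpha_{\pi_{\mathfrak s}(1)}+\beta_{\pi_{\mathfrak t}(1)}+n_{\pi_{\mathfrak s}(1)}+m_{\pi_{\mathfrak t}(1)}}{\bigl(\alpha_{\pi_{\mathfrak s}(k)}+\beta_{\pi_{\mathfrak t}(1)}+n_{\pi_{\mathfrak s}(k)}+m_{\pi_{\mathfrak t}(1)}-1\bigr)\bigl(\alpha_{\pi_{\mathfrak s}(1)}-\alpha_{\pi_{\mathfrak s}(k)}-n_{\pi_{\mathfrak s}(k)}+n_{\pi_{\mathfrak s}(1)}+1\bigr)}\\&\qquad\times\prod_{h=1}^q\frac{\alpha_{\pi_{\mathfrak s}(k)}+\beta_h+n_{\pi_{\mathfrak s}(k)}}{\alpha_{\pi_{\mathfrak s}(k)}+\beta_h+n_{\pi_{\mathfrak s}(k)}+m_h}\cdot\frac{\prod_{a=1}^p\bigl(\alpha_a-\alpha_{\pi_{\mathfrak s}(k)}-n_{\pi_{\mathfrak s}(k)}\bigr)}{\prod_{a=1,\,a\ne k}^p\bigl(\alpha_{\pi_{\mathfrak s}(a)}-\alpha_{\pi_{\mathfrak s}(k)}-n_{\pi_{\mathfrak s}(k)}+n_{\pi_{\mathfrak s}(a)}\bigr)},\end{aligned}$$ $$\begin{aligned}b^{-i}_{\vec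 n,\vec m}={}&\prod_{h=1}^q\frac{(\alpha_{\pi_s(i)}+\beta_h+n_{\pi_s(i)})_{(\vec m-\vec{\mathfrak t}_i)_h}}{(\alpha_{\pi_s(i)}+\beta_h+n_{\pi_s(i)})_{(\vec m-\vec{\mathfrak t}_{i+1})_h}}\\&\times\sum_{k=i}^p\prod_{h=1}^q\frac{(\alpha_{\pi_s(k)}+\beta_h+n_{\pi_s(k)})_{(\vec m-\vec{\mathfrak t}_{i+1})_h}}{(\alpha_{\pi_s(k)}+\beta_h+n_{\pi_s(k)}+1)_{m_h}}\cdot\frac{\prod_{a=1}^p\bigl(\alpha_{\pi_s(a)}-\alpha_{\pi_s(k)}-n_{\pi_s(k)}\bigr)}{\prod_{a=i,\,a\ne k}^p\bigl(\alpha_{\pi_s(a)}-\alpha_{\pi_s(k)}-n_{\pi_s(k)}+n_{\pi_s(a)}\bigr)}.\end{aligned}$$ The formula for $b^{-i}_{\vec n,\vec m}$ is asserted when the two shifted multi-indices in that term (that is, $\vec n-\vec s_i$ and $\vec m-\vec{\mathfrak t}_i$ in the backward term $b^{-i}_{\vec n,\vec m}B_{\vec n-\vec s_i,\vec m-\vec{\mathfrak t}_i}$) are nonnegative; otherwise that backward term is absent.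
   Context: $p,q\ge1$; real parameters satisfy $\alpha_i>-1$, $\beta_j>-1$, $\alpha_i+\beta_j>-1$ for all $1\le i\le p$, $1\le j\le q$; $\alpha_i-\alpha_h\notin\mathbb Z$ for $i\ne h$ and $\beta_j-\beta_s\notin\mathbb Z$ for $j\neq s$. Pochhammer symbols: $(z)_0=1$, $(z)_n=\prod_{r=0}^{n-1}(z+r)$, and $(z)_{-n}=1/(z-n)_n$ for $n\in\mathbb N$. Multi-indices have nonnegative integer components; $|\cdot|$ is the sum of the components and $(\cdot)_i$ the $i$-th component. Index paths: $\vec 1_d$ is the all-ones vector and $\vec e_k$ the $k$-th unit vector. For $r\in\mathbb N_0$, $\vec s_{rp+i}=r\vec 1_p+\sum_{k=1}^i\vec e_{\pi_s(k)}$, $\vec{\mathfrak s}_{rp+i}=r\vec 1_p+\sum_{k=1}^i\vec e_{\pi_{\mathfrak s}(k)}$ for $0\le i\le p-1$, and $\vec t_{rq+j}=r\vec 1_q+\sum_{k=1}^j\vec e_{\pi_t(k)}$, $\vec{\mathfrak t}_{rq+j}=r\vec 1_q+\sum_{k=1}^j\vec e_{\pi_{\mathfrak t}(k)}$ for $0\le j\le q-1$. Mixed Piñeiro forms in contour normalization (multiplicative constants set equal to 1), for $0<x<1$ with $x^t=\exp(t\log x)$: for $|\vec n|=|\vec m|+1$, $$A_{\vec n,\vec m}(x)=\int_\Sigma\frac{x^t\prod_{j=1}^q(t+\beta_j+1)_{m_j}}{\prod_{i=1}^p(\alpha_i-t)_{n_i}}\frac{\mathrm dt}{2\pi\mathrm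 i},$$ where $\Sigma$ is a clockwise contour enclosing once every point $\alpha_i+k$ ($0\le k\le n_i-1$, $1\le i\le p$) and no other pole; for $|\vec m|=|\vec n|+1$, $$B_{\vec n,\vec m}(x)=\int_\Sigma\frac{x^t\prod_{i=1}^p(t+\alpha_i+1)_{n_i}}{\prod_{j=1}^q(\beta_j-t)_{m_j}}\frac{\mathrm dt}{2\pi\mathrm i},$$ where $\Sigma$ is clockwise and encloses once every pole $\beta_j+k$ ($0\le k\le m_j-1$, $1\le j\le q$). These are the type-I and type-II mixed orthogonal forms: $A_{\vec n,\vec m}=\sum_iA^{(i)}_{\vec n,\vec m}x^{\alpha_i}$ with $A^{(i)}$ a polynomial of degree $\le n_i-1$ (zero if $n_i=0$) and $\int_0^1A_{\vec n,\vec m}x^{k+\beta_j}\mathrm dx=0$ for $0\le k\le m_j-1$, $1\le j\le q$; similarly $B_{\vec n,\vec m}=\sum_jB^{(j)}_{\vec n,\vec m}x^{\beta_j}$ with $\deg B^{(j)}\le m_j-1$ (zero if $m_j=0$) and $\int_0^1B_{\vec n,\vec m}x^{k+\alpha_i}\mathrm dx=0$ for $0\le k\le n_i-1$, $1\le i\le p$.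
   Formalization: The recurrence is claimed only if n_{π_s(i)}=0 for every absent backward term (it fails otherwise); b^0, b^{-i} and the recurrence exclude the cases where A has an index component −1 at j and α_c+β_j=0 for an enclosed α_c, where the defining quotient is undefined. *)

theory Defs
  imports
    "HOL-Complex_Analysis.Complex_Analysis"
    "HOL-Combinatorics.Permutations"
    "HOL-Library.Function_Algebras"
begin

(* Vectors with d components are functions on {1..d}; sums and differences of them are pointwise. *)

definition multi_index :: "nat \<Rightarrow> (nat \<Rightarrow> int) \<Rightarrow> bool" where
  "multi_index d u \<longleftrightarrow> (\<forall>a\<in>{1..d}. 0 \<le> u a)"

definition index_path :: "nat \<Rightarrow> (nat \<Rightarrow> nat) \<Rightarrow> nat \<Rightarrow> nat \<Rightarrow> int" where
  "index_path d \<pi> l a = int (l div d) + (\<Sum>k = 1..l mod d. if \<pi> k = a then 1 else 0)"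

definition ipoch :: "'a::field \<Rightarrow> int \<Rightarrow> 'a" where
  "ipoch z k = (if 0 \<le> k then pochhammer z (nat k) else 1 / pochhammer (z + of_int k) (nat (- k)))"

definition form_integrand ::
  "nat \<Rightarrow> (nat \<Rightarrow> real) \<Rightarrow> (nat \<Rightarrow> int) \<Rightarrow> nat \<Rightarrow> (nat \<Rightarrow> real) \<Rightarrow> (nat \<Rightarrow> int) \<Rightarrow> real \<Rightarrow> complex \<Rightarrow> complex"
where
  "form_integrand p a u q b v x t =
     exp (t * of_real (ln x)) * (\<Prod>j = 1..q. ipoch (t + of_real (b j) + 1) (v j))
       / (\<Prod>i = 1..p. ipoch (of_real (a i) - t) (u i))"

definition enclosed_poles :: "nat \<Rightarrow> (nat \<Rightarrow> real) \<Rightarrow> (nat \<Rightarrow> int) \<Rightarrow> complex set" where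
  "enclosed_poles p a u = {of_real (a i + real k) | i k. i \<in> {1..p} \<and> int k < u i}"

(* The poles of the factors (t + b_j + 1)_{v_j} with v_j < 0; empty if v is nonnegative.
   Vectors v with a component -1 occur in the recurrence coefficients. *)
definition other_poles :: "nat \<Rightarrow> (nat \<Rightarrow> real) \<Rightarrow> (nat \<Rightarrow> int) \<Rightarrow> complex set" where
  "other_poles q b v = {of_real (real k - b j) | j k. j \<in> {1..q} \<and> int k < - v j}"

definition form_contour ::
  "nat \<Rightarrow> (nat \<Rightarrow> real) \<Rightarrow> (nat \<Rightarrow> int) \<Rightarrow> nat \<Rightarrow> (nat \<Rightarrow> real) \<Rightarrow> (nat \<Rightarrow> int) \<Rightarrow> (real \<Rightarrow> complex) \<Rightarrow> bool"
where
  "form_contour p a u q b v \<gamma> \<longleftrightarrow>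
     valid_path \<gamma> \<and> pathfinish \<gamma> = pathstart \<gamma> \<and>
     path_image \<gamma> \<inter> (enclosed_poles p a u \<union> other_poles q b v) = {} \<and>
     (\<forall>z\<in>enclosed_poles p a u. winding_number \<gamma> z = - 1) \<and>
     (\<forall>z\<in>other_poles q b v. winding_number \<gamma> z = 0)"

(* By the residue theorem the value does not depend on the choice of the contour. *)
definition contour_form ::
  "nat \<Rightarrow> (nat \<Rightarrow> real) \<Rightarrow> (nat \<Rightarrow> int) \<Rightarrow> nat \<Rightarrow> (nat \<Rightarrow> real) \<Rightarrow> (nat \<Rightarrow> int) \<Rightarrow> real \<Rightarrow> complex"
where
  "contour_form p a u q b v x =
     contour_integral (SOME \<gamma>. form_contour p a u q b v \<gamma>) (form_integrand p a u q b v x)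
       / (2 * of_real pi * \<i>)"

definition pineiro_A ::
  "nat \<Rightarrow> nat \<Rightarrow> (nat \<Rightarrow> real) \<Rightarrow> (nat \<Rightarrow> real) \<Rightarrow> (nat \<Rightarrow> int) \<Rightarrow> (nat \<Rightarrow> int) \<Rightarrow> real \<Rightarrow> complex"
where
  "pineiro_A p q \<alpha> \<beta> n m = contour_form p \<alpha> n q \<beta> m"

definition pineiro_B ::
  "nat \<Rightarrow> nat \<Rightarrow> (nat \<Rightarrow> real) \<Rightarrow> (nat \<Rightarrow> real) \<Rightarrow> (nat \<Rightarrow> int) \<Rightarrow> (nat \<Rightarrow> int) \<Rightarrow> real \<Rightarrow> complex"
where
  "pineiro_B p q \<alpha> \<beta> n m = contour_form q \<beta> m p \<alpha> n"

(* Whether a contour as required for A exists: none of the points to be enclosed is at the same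
   time a pole of a factor (t + beta_j + 1)_{m_j}.  This always holds if m is nonnegative
   and alpha_i + beta_j > -1; it can fail only if some m_j < 0. *)
definition separated_A ::
  "nat \<Rightarrow> nat \<Rightarrow> (nat \<Rightarrow> real) \<Rightarrow> (nat \<Rightarrow> real) \<Rightarrow> (nat \<Rightarrow> int) \<Rightarrow> (nat \<Rightarrow> int) \<Rightarrow> bool"
where
  "separated_A p q \<alpha> \<beta> n m \<longleftrightarrow> enclosed_poles p \<alpha> n \<inter> other_poles q \<beta> m = {}"

definition pairing :: "(real \<Rightarrow> complex) \<Rightarrow> (real \<Rightarrow> complex) \<Rightarrow> complex" where
  "pairing f g = integral {0..1} (\<lambda>x. f x * g x)"

definition xpairing :: "(real \<Rightarrow> complex) \<Rightarrow> (real \<Rightarrow> complex) \<Rightarrow> complex" where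
  "xpairing f g = integral {0..1} (\<lambda>x. of_real x * f x * g x)"

end

theory Submission
  imports Defs
begin

text \<open>
  By the residue theorem a form is a finite sum \<open>\<Sum>z. c z * x powr z\<close> over the simple poles
  \<open>z = a i + k\<close>, and by partial fractions the Mellin transform of \<open>B n m\<close> is
  \<open>\<Prod>i. ipoch (\<alpha> i - \<sigma>) (n i) / \<Prod>j. ipoch (\<sigma> + \<beta> j + 1) (m j)\<close>, the reciprocal of the rational
  function whose residues are the coefficients of \<open>A n m\<close>.  Hence \<open>\<integral> A B\<close> and \<open>\<integral> x A B\<close> are finite sums
  over the poles of either form.  In the sums needed here nearly all terms vanish, and the remaining
  poles give the stated coefficients.

  For the recurrence, index the shifted forms by \<open>l = -r, \<dots>, q\<close> as \<open>B (N l) (M l)\<close>; then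
  \<open>A (N (l + 1)) (M (l - 1))\<close> is the dual system.  The Mellin transform of the difference of both sides
  is annihilated by all dual functionals, and as \<open>l\<close> grows these force one new zero each.  There are
  finally as many zeros as there are powers of \<open>x\<close> in the difference, so it vanishes identically.
\<close>

section \<open>Contours\<close>

text \<open>The obstacle sits at the bottom of the chain. Even if \<open>n - s i\<close> and
  \<open>m - \<tt> i\<close> are nonnegative, the dual index \<open>m - \<tt> (i + 1)\<close> may
  have a component -1. The integrand of \<open>A\<close> then has a further pole at
  \<open>- \<beta> j\<close>, which may coincide with a pole to be enclosed;
  \<open>separated_A\<close> excludes this. The numerator of such an \<open>A\<close> is no
  polynomial, so partial fractions do not give its Mellin transform, and it is paired by summing
  over its own poles and using the transform of \<open>B\<close>. This decides where each integral
  is evaluated: backward and middle coefficients at the poles of \<open>A\<close>, forward ones at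
  the poles of \<open>B\<close>. Biorthogonality survives, because the lowest dual form is only
  tested against higher \<open>B\<close>, where the vanishing is visible at the poles of
  \<open>A\<close>. Not all zeros of the transformed difference come from the functionals. Those at
  the nodes of the lowest \<open>N\<close> are there from the start, provided that every nonempty
  row is strictly shorter there than in \<open>n\<close>. If backward terms are absent, this forces
  the corresponding rows of \<open>n\<close> to be empty.\<close>

text \<open>The building block of all contours. The base point \<open>\<i>\<close> is the same for
  every block, so that blocks can be joined, and it lies off the real axis, which carries all
  poles.\<close>

lemma triangle_loop_real_point:
  fixes z \<delta> :: real
  assumes "\<delta> > 0"
  obtains \<gamma> where "valid_path \<gamma>" "pathstart \<gamma> = \<i>" "pathfinish \<gamma> = \<i>"
    "of_real z \<notin> path_image \<gamma>" "winding_number \<gamma> (of_real z) = -1"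
    "\<And>w::real. \<bar>w - z\<bar> > \<delta> \<Longrightarrow> of_real w \<notin> path_image \<gamma> \<and> winding_number \<gamma> (of_real w) = 0"
proof -
  \<comment> \<open>the triangle with vertices \<open>\<i>, b, c\<close> meets the real axis in \<open>{z - \<delta>..z + \<delta>}\<close>\<close>
  define b where "b = Complex (2 * z + 2 * \<delta>) (-1)"
  define c where "c = Complex (2 * z - 2 * \<delta>) (-1)"
  define \<gamma> where "\<gamma> = linepath \<i> b +++ linepath b c +++ linepath c \<i>"
  have ncol: "\<not> collinear {\<i>, b, c}"
  proof
    assume "collinear {\<i>, b, c}"
    then have "collinear {b, \<i>, c}" by (simp add: insert_commute)
    then consider "b = c" | u where "\<i> = u *\<^sub>R b + (1 - u) *\<^sub>R c"
      unfolding collinear_3_expand by blast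
    then show False
    proof cases
      case 1
      then show ?thesis using assms by (simp add: b_def c_def)
    next
      case 2
      then have "Im \<i> = Im (u *\<^sub>R b + (1 - u) *\<^sub>R c)" by simp
      then show ?thesis by (simp add: b_def c_def)
    qed
  qed
  have inn: "of_real z \<in> interior (convex hull {\<i>, b, c})"
    unfolding interior_convex_hull_3_minimal[OF ncol DIM_complex]
    \<comment> \<open>The midpoint of \<open>b\<close> and \<open>c\<close> is
      \<open>2 * z - \<i>\<close>, and \<open>z\<close> is the midpoint between that point and
      \<open>\<i>\<close>; hence the barycentric coordinates 1/2, 1/4, 1/4.\<close>
    by (rule CollectI, rule exI[of _ "1/2"], rule exI[of _ "1/4"], rule exI[of _ "1/4"])
       (auto simp: b_def c_def complex_eq_iff field_simps)
  have img: "path_image \<gamma> \<subseteq> convex hull {\<i>, b, c}"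
  proof -
    have "closed_segment x y \<subseteq> convex hull {\<i>, b, c}" if "x \<in> {\<i>,b,c}" "y \<in> {\<i>,b,c}" for x y
      using that by (intro closed_segment_subset_convex_hull) (auto intro: hull_inc)
    then show ?thesis by (auto simp: \<gamma>_def path_image_join)
  qed
  have out: "of_real w \<notin> convex hull {\<i>, b, c}" if "\<bar>w - z\<bar> > \<delta>" for w :: real
  proof
    assume "of_real w \<in> convex hull {\<i>, b, c}"
    then obtain x y v where *: "0 \<le> x" "0 \<le> y" "0 \<le> v" "x + y + v = 1"
      "of_real w = x *\<^sub>R \<i> + y *\<^sub>R b + v *\<^sub>R c"
      by (auto simp: convex_hull_3)
    have "Im (of_real w) = Im (x *\<^sub>R \<i> + y *\<^sub>R b + v *\<^sub>R c)"
      and "Re (of_real w) = Re (x *\<^sub>R \<i> + y *\<^sub>R b + v *\<^sub>R c)" using *(5) by simp_all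
    then have im: "x = y + v" and re: "w = y * (2 * z + 2 * \<delta>) + v * (2 * z - 2 * \<delta>)"
      by (simp_all add: b_def c_def)
    from im * have v: "v = 1/2 - y" by simp
    \<comment> \<open>A real point of the triangle puts weight 1/2 on \<open>\<i>\<close>, so
      \<open>y\<close> ranges over [0, 1/2].\<close>
    have "w = z + (4 * y - 1) * \<delta>" unfolding re v by (simp add: algebra_simps)
    moreover have "\<bar>4 * y - 1\<bar> \<le> 1" using v * by auto
    ultimately have "\<bar>w - z\<bar> \<le> 1 * \<delta>" using assms
      by (simp add: abs_mult mult_right_mono del: mult_1_left)
    with that show False by simp
  qed
  show thesis
  proof
    show "valid_path \<gamma>" by (auto simp: \<gamma>_def intro!: valid_path_join)
    show st: "pathstart \<gamma> = \<i>" and fi: "pathfinish \<gamma> = \<i>" by (auto simp: \<gamma>_def)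
    show "of_real z \<notin> path_image \<gamma>"
      using interior_of_triangle[OF DIM_complex, of \<i> b c] inn
      by (auto simp: \<gamma>_def path_image_join)
    \<comment> \<open>Top, bottom right, bottom left: the orientation is clockwise.\<close>
    show "winding_number \<gamma> (of_real z) = -1"
      unfolding \<gamma>_def winding_number_triangle[OF inn]
      using assms by (simp add: b_def algebra_simps)
    fix w :: real assume w: "\<bar>w - z\<bar> > \<delta>"
    have "winding_number \<gamma> (of_real w) = 0"
      by (rule winding_number_zero_outside[OF _ convex_convex_hull _ out[OF w] img])
        (use st fi in \<open>auto simp: \<gamma>_def intro!: path_join_imp\<close>)
    then show "of_real w \<notin> path_image \<gamma> \<and> winding_number \<gamma> (of_real w) = 0"
      using out[OF w] img by auto
  qed
qed

text \<open>One clockwise triangle is joined for each point of \<open>E\<close>, narrow enough to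
  miss the rest of \<open>F\<close>; winding numbers add under joining. The points of
  \<open>F\<close> outside \<open>E\<close> will be the poles that must not be encircled.\<close>

lemma loop_around_real_points:
  fixes E F :: "real set"
  assumes "finite F" "E \<subseteq> F"
  shows "\<exists>\<gamma>. valid_path \<gamma> \<and> pathstart \<gamma> = \<i> \<and> pathfinish \<gamma> = \<i> \<and>
     (\<forall>w\<in>F. of_real w \<notin> path_image \<gamma> \<and> winding_number \<gamma> (of_real w) = (if w \<in> E then -1 else 0))"
  using finite_subset[OF assms(2,1)] assms(2)
proof (induction E rule: finite_induct)
  case empty
  have "of_real w \<noteq> \<i>" for w by (simp add: complex_eq_iff)
  then have "\<forall>w\<in>F. of_real w \<notin> path_image (linepath \<i> \<i>) \<and> winding_number (linepath \<i> \<i>) (of_real w) = 0"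
    by (metis closed_segment_idem path_image_linepath singletonD winding_number_trivial)
  then show ?case
    by (metis empty_iff pathfinish_linepath pathstart_linepath valid_path_linepath)
next
  case (insert z E)
  then obtain \<gamma> where \<gamma>: "valid_path \<gamma>" "pathstart \<gamma> = \<i>" "pathfinish \<gamma> = \<i>"
     "\<And>w. w \<in> F \<Longrightarrow> of_real w \<notin> path_image \<gamma>"
     "\<And>w. w \<in> F \<Longrightarrow> winding_number \<gamma> (of_real w) = (if w \<in> E then -1 else 0)"
    by auto
  obtain d where d: "d > 0" "\<And>w. w \<in> F \<Longrightarrow> w \<noteq> z \<Longrightarrow> d \<le> dist z w"
    using finite_set_avoid[OF assms(1), of z] by blast
  obtain \<tau> where \<tau>: "valid_path \<tau>" "pathstart \<tau> = \<i>" "pathfinish \<tau> = \<i>"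
    "of_real z \<notin> path_image \<tau>" "winding_number \<tau> (of_real z) = -1"
    "\<And>w::real. \<bar>w - z\<bar> > d/2 \<Longrightarrow> of_real w \<notin> path_image \<tau> \<and> winding_number \<tau> (of_real w) = 0"
    using triangle_loop_real_point[of "d/2" z] d(1) by (metis half_gt_zero)
  have \<tau>F: "of_real w \<notin> path_image \<tau> \<and> winding_number \<tau> (of_real w) = (if w = z then -1 else 0)"
    if "w \<in> F" for w
  proof (cases "w = z")
    case False
    then have "\<bar>w - z\<bar> > d/2" using d(1) d(2)[OF that False] unfolding dist_real_def by linarith
    then show ?thesis using \<tau>(6)[of w] False by auto
  qed (use \<tau> in auto)
  have "of_real w \<notin> path_image (\<gamma> +++ \<tau>) \<and>
      winding_number (\<gamma> +++ \<tau>) (of_real w) = (if w \<in> insert z E then -1 else 0)" if "w \<in> F" for w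
  proof -
    have "winding_number (\<gamma> +++ \<tau>) (of_real w) =
        winding_number \<gamma> (of_real w) + winding_number \<tau> (of_real w)"
      using \<gamma>(1-3) \<tau>(1-3) \<gamma>(4)[OF that] \<tau>F[OF that]
      by (intro winding_number_join) (auto simp: valid_path_imp_path)
    moreover have "of_real w \<notin> path_image (\<gamma> +++ \<tau>)"
      using \<gamma>(2,3) \<tau>(2) \<gamma>(4)[OF that] \<tau>F[OF that] by (simp add: path_image_join)
    ultimately show ?thesis
      using \<gamma>(5)[OF that] \<tau>F[OF that] \<open>z \<notin> E\<close> by auto
  qed
  moreover have "valid_path (\<gamma> +++ \<tau>)" using \<gamma>(1-3) \<tau>(1-3) by (intro valid_path_join) auto
  moreover have "pathstart (\<gamma> +++ \<tau>) = \<i>" "pathfinish (\<gamma> +++ \<tau>) = \<i>" using \<gamma> \<tau> by simp_all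
  ultimately show ?case by blast
qed

section \<open>Forms as sums of powers\<close>

text \<open>The enclosed poles as real numbers, so that weights, transforms and sums can be computed
  over the reals.\<close>

definition nodes :: "nat \<Rightarrow> (nat \<Rightarrow> real) \<Rightarrow> (nat \<Rightarrow> int) \<Rightarrow> real set" where
  "nodes d a u = {a i + real k | i k. i \<in> {1..d} \<and> int k < u i}"

definition nonint_diffs :: "nat \<Rightarrow> (nat \<Rightarrow> real) \<Rightarrow> bool" where
  "nonint_diffs d a \<longleftrightarrow> (\<forall>i\<in>{1..d}. \<forall>h\<in>{1..d}. i \<noteq> h \<longrightarrow> a i - a h \<notin> \<int>)"

text \<open>The denominator of the integrand is a \<open>zprod\<close>, its numerator a
  \<open>pprod\<close> of the other family. For nonnegative indices \<open>zprod\<close> vanishes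
  exactly on the nodes, while \<open>pprod\<close> is positive on the nodes of the other
  family.\<close>

definition zprod :: "nat \<Rightarrow> (nat \<Rightarrow> real) \<Rightarrow> (nat \<Rightarrow> int) \<Rightarrow> real \<Rightarrow> real" where
  "zprod d a u z = (\<Prod>i = 1..d. ipoch (a i - z) (u i))"

definition pprod :: "nat \<Rightarrow> (nat \<Rightarrow> real) \<Rightarrow> (nat \<Rightarrow> int) \<Rightarrow> real \<Rightarrow> real" where
  "pprod d b v z = (\<Prod>j = 1..d. ipoch (z + b j + 1) (v j))"

text \<open>Minus the residue of the reciprocal of \<open>zprod d a u\<close> at the node
  \<open>z\<close>; the clockwise orientation absorbs the sign.\<close>

definition node_weight :: "nat \<Rightarrow> (nat \<Rightarrow> real) \<Rightarrow> (nat \<Rightarrow> int) \<Rightarrow> real \<Rightarrow> real" where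
  "node_weight d a u z = inverse (\<Prod>w\<in>nodes d a u - {z}. w - z)"

definition form_coeff ::
  "nat \<Rightarrow> (nat \<Rightarrow> real) \<Rightarrow> (nat \<Rightarrow> int) \<Rightarrow> nat \<Rightarrow> (nat \<Rightarrow> real) \<Rightarrow> (nat \<Rightarrow> int) \<Rightarrow> real \<Rightarrow> real"
where
  "form_coeff p a u q b v z = node_weight p a u z * pprod q b v z"

lemma nodes_eq_image: "nodes d a u = (\<lambda>(i,k). a i + real k) ` (SIGMA i:{1..d}. {..<nat (u i)})"
proof (intro equalityI subsetI)
  fix z assume "z \<in> nodes d a u"
  then obtain i k where "i \<in> {1..d}" "int k < u i" "z = a i + real k" unfolding nodes_def by blast
  then show "z \<in> (\<lambda>(i,k). a i + real k) ` (SIGMA i:{1..d}. {..<nat (u i)})"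
    by (intro image_eqI[of _ _ "(i,k)"]) auto
next
  fix z assume "z \<in> (\<lambda>(i,k). a i + real k) ` (SIGMA i:{1..d}. {..<nat (u i)})"
  then obtain i k where "i \<in> {1..d}" "k < nat (u i)" "z = a i + real k" by auto
  moreover from this have "int k < u i" by simp
  ultimately show "z \<in> nodes d a u" unfolding nodes_def by blast
qed

lemma finite_nodes [simp]: "finite (nodes d a u)"
  unfolding nodes_eq_image by auto

lemma nonint_diffs_eqD:
  assumes "nonint_diffs d a" "i \<in> {1..d}" "h \<in> {1..d}" "a i + of_int k = a h + of_int l"
  shows "i = h \<and> k = l"
proof (cases "i = h")
  case False
  have "a i - a h = of_int (l - k)" using assms(4) by simp
  then have "a i - a h \<in> \<int>" by (metis Ints_of_int)
  with False assms show ?thesis unfolding nonint_diffs_def by blast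
qed (use assms in auto)

lemma inj_on_nodes:
  assumes "nonint_diffs d a"
  shows "inj_on (\<lambda>(i,k). a i + real k) (SIGMA i:{1..d}. {..<nat (u i)})"
proof (rule inj_onI, clarify)
  fix i k h l
  assume *: "i \<in> {1..d}" "h \<in> {1..d}" "a i + real k = a h + real l"
  then show "i = h \<and> k = l"
    using nonint_diffs_eqD[OF assms *(1,2), of "int k" "int l"] by simp
qed

lemma card_nodes:
  assumes "nonint_diffs d a"
  shows "card (nodes d a u) = (\<Sum>i = 1..d. nat (u i))"
  unfolding nodes_eq_image card_image[OF inj_on_nodes[OF assms]] by simp

lemma card_nodes_int:
  assumes "nonint_diffs d a" "multi_index d u"
  shows "int (card (nodes d a u)) = (\<Sum>i = 1..d. u i)"
  using assms by (simp add: card_nodes multi_index_def)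

text \<open>The offset is an integer because nodes are compared with their neighbours:
  \<open>u i - 1\<close> is the last offset of row \<open>i\<close>, and \<open>u i\<close> is the
  first one missing.\<close>

lemma mem_nodes_iff:
  assumes "nonint_diffs d a" "i \<in> {1..d}"
  shows "a i + of_int k \<in> nodes d a u \<longleftrightarrow> 0 \<le> k \<and> k < u i"
proof
  assume "a i + of_int k \<in> nodes d a u"
  then obtain h l where *: "h \<in> {1..d}" "int l < u h" "a i + of_int k = a h + of_int (int l)"
    by (auto simp: nodes_def)
  from nonint_diffs_eqD[OF assms *(1,3)] * show "0 \<le> k \<and> k < u i" by auto
next
  assume "0 \<le> k \<and> k < u i"
  then show "a i + of_int k \<in> nodes d a u" 
    using assms(2) unfolding nodes_def by (intro CollectI exI[of _ i] exI[of _ "nat k"]) auto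
qed

lemma nodes_mono: "(\<And>i. i \<in> {1..d} \<Longrightarrow> u i \<le> v i) \<Longrightarrow> nodes d a u \<subseteq> nodes d a v"
  unfolding nodes_def by (blast intro: less_le_trans)

lemma prod_ipoch_eq_prod_nodes:
  fixes t :: "'a :: real_normed_field"
  assumes "nonint_diffs d a" "multi_index d u"
  shows "(\<Prod>i = 1..d. ipoch (of_real (a i) - t) (u i)) = (\<Prod>w\<in>nodes d a u. of_real w - t)"
proof -
  have "(\<Prod>i = 1..d. ipoch (of_real (a i) - t) (u i)) =
        (\<Prod>i = 1..d. \<Prod>k\<in>{..<nat (u i)}. of_real (a i + real k) - t)"
    using assms(2)
    by (intro prod.cong refl)
       (auto simp: multi_index_def ipoch_def pochhammer_prod atLeast0LessThan algebra_simps intro!: prod.cong)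
  also have "\<dots> = (\<Prod>w\<in>nodes d a u. of_real w - t)"
    unfolding nodes_eq_image prod.reindex[OF inj_on_nodes[OF assms(1)]]
    by (subst prod.Sigma) (auto simp: case_prod_unfold)
  finally show ?thesis .
qed

lemma zprod_eq_prod_nodes:
  assumes "nonint_diffs d a" "multi_index d u"
  shows "zprod d a u z = (\<Prod>w\<in>nodes d a u. w - z)"
  using prod_ipoch_eq_prod_nodes[OF assms, of z] by (simp add: zprod_def)

text \<open>The reflection behind the Mellin transforms: the numerator of a form, taken at
  \<open>- \<sigma> - 1\<close>, becomes a zero product at \<open>\<sigma>\<close>.\<close>

lemma pprod_eq_zprod: "pprod d b v z = zprod d b v (- z - 1)"
  by (simp add: pprod_def zprod_def algebra_simps)

lemma pprod_eq_prod_nodes: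
  assumes "nonint_diffs d a" "multi_index d u"
  shows "pprod d a u z = (\<Prod>w\<in>nodes d a u. w + z + 1)"
  unfolding pprod_eq_zprod zprod_eq_prod_nodes[OF assms] by (simp add: algebra_simps)

lemma enclosed_poles_eq_image: "enclosed_poles p a u = of_real ` nodes p a u"
  unfolding enclosed_poles_def nodes_def by blast

lemma finite_other_poles [simp]: "finite (other_poles q b v)"
proof -
  have "other_poles q b v \<subseteq> (\<lambda>(j,k). of_real (real k - b j)) ` ({1..q} \<times> {..<nat (Max ((\<lambda>j. - v j) ` {1..q}))})"
  proof
    fix z assume "z \<in> other_poles q b v"
    then obtain j k where *: "j \<in> {1..q}" "int k < - v j" "z = of_real (real k - b j)"
      unfolding other_poles_def by blast
    have "int k < Max ((\<lambda>j. - v j) ` {1..q})" 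
      using *(1) by (intro less_le_trans[OF *(2)] Max_ge) auto
    then show "z \<in> (\<lambda>(j,k). of_real (real k - b j)) ` ({1..q} \<times> {..<nat (Max ((\<lambda>j. - v j) ` {1..q}))})"
      using * by (intro image_eqI[of _ _ "(j,k)"]) (simp_all del: One_nat_def)
  qed
  then show ?thesis by (rule finite_subset) auto
qed

text \<open>\<open>contour_form\<close> picks its contour by \<open>SOME\<close>, so the residue
  theorem applies only once a contour exists. Disjointness prevents a point from being asked to have
  winding numbers -1 and 0 at once.\<close>

lemma ex_form_contour:
  assumes "enclosed_poles p a u \<inter> other_poles q b v = {}"
  shows "\<exists>\<gamma>. form_contour p a u q b v \<gamma>"
proof -
  define R where "R = Re ` other_poles q b v"
  have oR: "other_poles q b v = of_real ` R"
    unfolding R_def other_poles_def by (auto simp: image_iff) (metis Re_complex_of_real of_real_diff of_real_of_nat_eq)+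
  have disj: "nodes p a u \<inter> R = {}"
    using assms unfolding oR enclosed_poles_eq_image by auto
  have "finite (nodes p a u \<union> R)" by (simp add: R_def)
  from loop_around_real_points[OF this, of "nodes p a u"] obtain \<gamma> where
    "valid_path \<gamma>" "pathstart \<gamma> = \<i>" "pathfinish \<gamma> = \<i>"
     "\<forall>w\<in>nodes p a u \<union> R. of_real w \<notin> path_image \<gamma> \<and> winding_number \<gamma> (of_real w) = (if w \<in> nodes p a u then -1 else 0)"
    by auto
  then have "form_contour p a u q b v \<gamma>"
    unfolding form_contour_def oR enclosed_poles_eq_image using disj by auto
  then show ?thesis by blast
qed

lemma ipoch_of_real: "ipoch (of_real x :: 'a :: real_normed_field) k = of_real (ipoch x k)"
proof -
  have "of_real x + of_int k = (of_real (x + of_int k) :: 'a)" by simp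
  then show ?thesis by (simp only: ipoch_def pochhammer_of_real of_real_divide of_real_1 split: if_split) simp
qed

lemma holomorphic_ipoch:
  assumes "\<And>t k. t \<in> S \<Longrightarrow> int k < - l \<Longrightarrow> t \<noteq> of_real (real k - c)"
  shows "(\<lambda>t. ipoch (t + of_real c + 1) l) holomorphic_on S"
proof (cases "0 \<le> l")
  case True
  then show ?thesis unfolding ipoch_def pochhammer_prod by (auto intro!: holomorphic_intros)
next
  case False
  have "(\<Prod>i = 0..<nat (- l). t + of_real c + 1 + of_int l + of_nat i) \<noteq> 0" if "t \<in> S" for t
  proof
    assume "(\<Prod>i = 0..<nat (- l). t + of_real c + 1 + of_int l + of_nat i) = 0"
    then obtain i where i: "i < nat (- l)" "t + of_real c + 1 + of_int l + of_nat i = 0" by auto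
    \<comment> \<open>The factors of the denominator run through the poles in reverse order: factor
      \<open>i\<close> vanishes at the pole with index \<open>- l - 1 - i\<close>.\<close>
    define k where "k = nat (- l - 1 - int i)"
    have k: "int k = - l - 1 - int i" using i False unfolding k_def by auto
    then have "of_nat k = (- of_int l - 1 - of_nat i :: complex)"
      by (metis of_int_1 of_int_diff of_int_minus of_int_of_nat_eq)
    then have "t + of_real c - of_nat k = t + of_real c + 1 + of_int l + of_nat i" by simp
    then have "t + of_real c - of_nat k = 0" using i(2) by metis
    then have "t = of_real (real k - c)" by (simp add: algebra_simps)
    with assms[OF that, of k] k show False by auto
  qed
  then show ?thesis using False unfolding ipoch_def pochhammer_prod by (auto intro!: holomorphic_intros)
qed

text \<open>The powers keep the shape \<open>exp (z * ln x)\<close> of the integrand, so the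
  identity holds for every real \<open>x\<close>; the change to \<open>powr\<close> is left to the
  integrals.\<close>

lemma contour_form_eq_sum:
  assumes "nonint_diffs p a" "multi_index p u"
    and disj: "enclosed_poles p a u \<inter> other_poles q b v = {}"
  shows "contour_form p a u q b v x =
    of_real (\<Sum>z\<in>nodes p a u. form_coeff p a u q b v z * exp (z * ln x))"
proof -
  define N where "N = nodes p a u"
  define Oth where "Oth = other_poles q b v"
  define g where "g = (\<lambda>t. exp (t * of_real (ln x)) * (\<Prod>j = 1..q. ipoch (t + of_real (b j) + 1) (v j)) :: complex)"
  define F where "F = form_integrand p a u q b v x"
  define \<gamma> where "\<gamma> = (SOME \<gamma>. form_contour p a u q b v \<gamma>)"
  have fN: "finite N" by (simp add: N_def)
  have fO: "finite Oth" by (simp add: Oth_def)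
  have F_eq: "F t = g t / (\<Prod>w\<in>N. of_real w - t)" for t
    unfolding F_def form_integrand_def g_def prod_ipoch_eq_prod_nodes[OF assms(1,2)] N_def by simp
  have \<gamma>: "form_contour p a u q b v \<gamma>"
    unfolding \<gamma>_def using ex_form_contour[OF disj] by (rule someI_ex)
  have g_holo: "g holomorphic_on S" if "S \<inter> Oth = {}" for S
    unfolding g_def using that
    by (intro holomorphic_intros holomorphic_ipoch) (auto simp: Oth_def other_poles_def)
  have disj': "of_real ` N \<inter> Oth = {}"
    using disj by (simp add: N_def Oth_def enclosed_poles_eq_image)
  have F_holo: "F holomorphic_on UNIV - (of_real ` N \<union> Oth)"
    unfolding F_eq using fN by (intro holomorphic_intros g_holo) (auto simp: prod_zero_iff)
  have res: "residue F (of_real z) = - of_real (form_coeff p a u q b v z * exp (z * ln x))" if z: "z \<in> N" for z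
  proof -
    \<comment> \<open>The denominator contains \<open>z - t\<close>, whereas the residue rule
      expects \<open>t - z\<close>; hence the sign in \<open>h\<close>.\<close>
    define h where "h = (\<lambda>t. - g t / (\<Prod>w\<in>N - {z}. of_real w - t))"
    have F_h: "F = (\<lambda>t. h t / (t - of_real z))"
    proof
      fix t :: complex
      have "(\<Prod>w\<in>N. of_real w - t) = (of_real z - t) * (\<Prod>w\<in>N - {z}. of_real w - t)"
        using z fN by (simp add: prod.remove)
      then show "F t = h t / (t - of_real z)"
        unfolding F_eq h_def
        by (metis (no_types, lifting) divide_divide_eq_left minus_diff_eq minus_divide_divide mult.commute mult_minus_right)
    qed
    have "residue F (of_real z) = h (of_real z)"
      unfolding F_h
    proof (rule residue_simple)
      show "open (- (of_real ` (N - {z}) \<union> Oth))"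
        using fN fO by (intro open_Compl finite_imp_closed) auto
      show "of_real z \<in> - (of_real ` (N - {z}) \<union> Oth)" using z disj' by auto
      show "h holomorphic_on - (of_real ` (N - {z}) \<union> Oth)"
        unfolding h_def using fN by (intro holomorphic_intros g_holo) (auto simp: prod_zero_iff)
    qed
    also have "\<dots> = - of_real (form_coeff p a u q b v z * exp (z * ln x))"
    proof -
      have "ipoch (of_real z + of_real (b j) + 1) (v j) = (of_real (ipoch (z + b j + 1) (v j)) :: complex)" for j
        by (simp flip: ipoch_of_real)
      moreover have "exp (of_real z * of_real (ln x)) = (of_real (exp (z * ln x)) :: complex)"
        by (simp add: exp_of_real flip: of_real_mult)
      moreover have "(\<Prod>w\<in>N - {z}. of_real w - of_real z) = (of_real (\<Prod>w\<in>N - {z}. w - z) :: complex)"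
        by simp
      ultimately show ?thesis
        by (simp add: h_def g_def form_coeff_def node_weight_def pprod_def N_def field_simps)
    qed
    finally show ?thesis .
  qed
  have "contour_integral \<gamma> F = 2 * pi * \<i> * (\<Sum>w\<in>of_real ` N \<union> Oth. winding_number \<gamma> w * residue F w)"
    by (rule Residue_theorem[OF open_UNIV connected_UNIV _ F_holo])
       (use \<gamma> fN fO in \<open>auto simp: form_contour_def enclosed_poles_eq_image N_def Oth_def\<close>)
  also have "(\<Sum>w\<in>of_real ` N \<union> Oth. winding_number \<gamma> w * residue F w) =
      (\<Sum>w\<in>of_real ` N. winding_number \<gamma> w * residue F w)"
    using fN fO \<gamma> by (intro sum.mono_neutral_right) (auto simp: form_contour_def Oth_def)
  also have "\<dots> = (\<Sum>z\<in>N. winding_number \<gamma> (of_real z) * residue F (of_real z))"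
    by (subst sum.reindex) (auto simp: inj_on_def)
  also have "\<dots> = (\<Sum>z\<in>N. of_real (form_coeff p a u q b v z * exp (z * ln x)))"
    using \<gamma> by (intro sum.cong) (auto simp: res form_contour_def enclosed_poles_eq_image N_def)
  finally show ?thesis
    unfolding contour_form_def by (simp add: N_def flip: \<gamma>_def F_def)
qed

section \<open>Pairings and Mellin transforms\<close>

definition power_sum :: "real set \<Rightarrow> (real \<Rightarrow> real) \<Rightarrow> real \<Rightarrow> real" where
  "power_sum Z c x = (\<Sum>z\<in>Z. c z * exp (z * ln x))"

lemma has_integral_power_double_sum:
  fixes c d :: "real \<Rightarrow> real"
  assumes "\<And>z y. z \<in> Z \<Longrightarrow> y \<in> Y \<Longrightarrow> z + y + e > -1"
  shows "((\<lambda>x. complex_of_real (\<Sum>z\<in>Z. \<Sum>y\<in>Y. c z * d y * x powr (z + y + e))) has_integral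
     of_real (\<Sum>z\<in>Z. \<Sum>y\<in>Y. c z * d y / (z + y + e + 1))) {0..1}"
proof (cases "finite Z \<and> finite Y")
  case True
  have "((\<lambda>x. c z * d y * x powr (z + y + e)) has_integral c z * d y * (1 / (z + y + e + 1))) {0..1}"
    if "z \<in> Z" "y \<in> Y" for z y
    using has_integral_powr_from_0[OF assms[OF that], of 1] by (intro has_integral_mult_right) simp
  then have "((\<lambda>x. \<Sum>z\<in>Z. \<Sum>y\<in>Y. c z * d y * x powr (z + y + e)) has_integral
     (\<Sum>z\<in>Z. \<Sum>y\<in>Y. c z * d y * (1 / (z + y + e + 1)))) {0..1}"
    using True by (intro has_integral_sum) auto
  from has_integral_linear[OF this bounded_linear_of_real[where 'a = complex]] show ?thesis
    by (simp add: o_def)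
next
  case False
  then show ?thesis by (auto simp: has_integral_0)
qed

lemma power_sum_mult:
  assumes "x > 0"
  shows "x powr e * power_sum Z c x * power_sum Y d x = (\<Sum>z\<in>Z. \<Sum>y\<in>Y. c z * d y * x powr (z + y + e))"
  unfolding power_sum_def mult.assoc sum_product
  unfolding sum_distrib_left using assms
  by (intro sum.cong refl) (simp add: powr_def exp_add ring_distribs)

lemma pairing_power_sum:
  assumes "\<And>z y. z \<in> Z \<Longrightarrow> y \<in> Y \<Longrightarrow> z + y > -1"
  shows "pairing (\<lambda>x. of_real (power_sum Z c x)) (\<lambda>x. of_real (power_sum Y d x)) =
    of_real (\<Sum>z\<in>Z. \<Sum>y\<in>Y. c z * d y / (z + y + 1))"
proof -
  have "((\<lambda>x. complex_of_real (power_sum Z c x) * of_real (power_sum Y d x)) has_integral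
     of_real (\<Sum>z\<in>Z. \<Sum>y\<in>Y. c z * d y / (z + y + 0 + 1))) {0..1}"
  proof (rule has_integral_spike_finite[OF _ _ has_integral_power_double_sum])
    \<comment> \<open>The integrands differ at \<open>x = 0\<close>: \<open>ln 0 = 0\<close> turns
      each exponential into 1, while \<open>0 powr s = 0\<close>. That single point is
      discarded.\<close>
    fix x :: real assume "x \<in> {0..1} - {0}"
    then have "x > 0" by auto
    from power_sum_mult[OF this, of 0 Z c Y d] \<open>x > 0\<close>
    show "complex_of_real (power_sum Z c x) * of_real (power_sum Y d x) =
      complex_of_real (\<Sum>z\<in>Z. \<Sum>y\<in>Y. c z * d y * x powr (z + y + 0))"
      by (simp del: of_real_sum flip: of_real_mult)
  qed (use assms in auto)
  then show ?thesis unfolding pairing_def by (simp add: integral_unique del: of_real_sum)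
qed

lemma xpairing_power_sum:
  assumes "\<And>z y. z \<in> Z \<Longrightarrow> y \<in> Y \<Longrightarrow> z + y > -1"
  shows "xpairing (\<lambda>x. of_real (power_sum Z c x)) (\<lambda>x. of_real (power_sum Y d x)) =
    of_real (\<Sum>z\<in>Z. \<Sum>y\<in>Y. c z * d y / (z + y + 2))"
proof -
  have "((\<lambda>x. of_real x * complex_of_real (power_sum Z c x) * of_real (power_sum Y d x)) has_integral
     of_real (\<Sum>z\<in>Z. \<Sum>y\<in>Y. c z * d y / (z + y + 1 + 1))) {0..1}"
  proof (rule has_integral_spike_finite[OF _ _ has_integral_power_double_sum])
    fix x :: real assume "x \<in> {0..1} - {0}"
    then have "x > 0" by auto
    from power_sum_mult[OF this, of 1 Z c Y d] \<open>x > 0\<close>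
    show "of_real x * complex_of_real (power_sum Z c x) * of_real (power_sum Y d x) =
      complex_of_real (\<Sum>z\<in>Z. \<Sum>y\<in>Y. c z * d y * x powr (z + y + 1))"
      by (simp del: of_real_sum flip: of_real_mult)
  qed (use assms in force)+
  then show ?thesis unfolding xpairing_def by (simp add: integral_unique add.assoc del: of_real_sum)
qed

section \<open>Partial fractions and Cauchy systems\<close>

text \<open>The numerator of \<open>\<Sum>y\<in>Y. c y / (y - x)\<close> over the common denominator
  \<open>\<Prod>w\<in>Y. w - x\<close>.\<close>

definition node_poly :: "real set \<Rightarrow> (real \<Rightarrow> real) \<Rightarrow> real poly" where
  "node_poly Y c = (\<Sum>y\<in>Y. smult (c y) (\<Prod>w\<in>Y - {y}. [:w, -1:]))"

lemma degree_node_poly: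
  assumes "finite Y" "Y \<noteq> {}"
  shows "degree (node_poly Y c) < card Y"
  unfolding node_poly_def
proof (rule degree_sum_less)
  fix y assume "y \<in> Y"
  have "degree (smult (c y) (\<Prod>w\<in>Y - {y}. [:w, -1:])) \<le> degree (\<Prod>w\<in>Y - {y}. [:w, -1:])"
    by (rule degree_smult_le)
  also have "\<dots> \<le> (\<Sum>w\<in>Y - {y}. degree [:w, -1:])" 
    using degree_prod_sum_le[of "Y - {y}" "\<lambda>w. [:w, -1:]"] assms by (simp add: o_def)
  also have "\<dots> = card Y - 1" using assms \<open>y \<in> Y\<close> by simp
  also have "\<dots> < card Y" using assms by (simp add: card_gt_0_iff)
  finally show "degree (smult (c y) (\<Prod>w\<in>Y - {y}. [:w, -1:])) < card Y" .
qed (use assms in \<open>simp add: card_gt_0_iff\<close>)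

lemma poly_node_poly:
  assumes "finite Y" "x \<notin> Y"
  shows "poly (node_poly Y c) x = (\<Prod>w\<in>Y. w - x) * (\<Sum>y\<in>Y. c y / (y - x))"
  unfolding node_poly_def poly_sum sum_distrib_left
proof (rule sum.cong[OF refl])
  fix y assume "y \<in> Y"
  then have "(\<Prod>w\<in>Y. w - x) = (y - x) * (\<Prod>w\<in>Y - {y}. w - x)" "y \<noteq> x"
    using assms by (auto simp: prod.remove)
  then show "poly (smult (c y) (\<Prod>w\<in>Y - {y}. [:w, -1:])) x = (\<Prod>w\<in>Y. w - x) * (c y / (y - x))"
    by (simp add: poly_prod)
qed

lemma poly_node_poly_node:
  assumes "finite Y" "y \<in> Y"
  shows "poly (node_poly Y c) y = c y * (\<Prod>w\<in>Y - {y}. w - y)"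
proof -
  have "poly (node_poly Y c) y = (\<Sum>v\<in>Y. c v * (\<Prod>w\<in>Y - {v}. w - y))"
    by (simp add: node_poly_def poly_sum poly_prod)
  also have "\<dots> = (\<Sum>v\<in>{y}. c v * (\<Prod>w\<in>Y - {v}. w - y))"
    using assms by (intro sum.mono_neutral_right) auto
  finally show ?thesis by simp
qed

text \<open>Lagrange interpolation: \<open>f\<close> and the numerator of the left side both have
  degree below \<open>card Y\<close> and agree on \<open>Y\<close>.\<close>

lemma partial_fractions:
  fixes f :: "real poly"
  assumes "finite Y" "degree f < card Y" "x \<notin> Y"
  shows "(\<Sum>y\<in>Y. inverse (\<Prod>w\<in>Y - {y}. w - y) * poly f y / (y - x)) = poly f x / (\<Prod>w\<in>Y. w - x)"
proof -
  define c where "c = (\<lambda>y. inverse (\<Prod>w\<in>Y - {y}. w - y) * poly f y)"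
  have "node_poly Y c = f"
  proof (rule poly_eqI_degree)
    fix y assume "y \<in> Y"
    then show "poly (node_poly Y c) y = poly f y"
      using assms(1) by (simp add: poly_node_poly_node c_def field_simps)
  next
    show "degree (node_poly Y c) < card Y" using assms by (intro degree_node_poly) auto
  qed (use assms in auto)
  moreover have "(\<Prod>w\<in>Y. w - x) \<noteq> 0" using assms by auto
  ultimately show ?thesis using poly_node_poly[OF assms(1,3), of c] by (simp add: c_def field_simps)
qed

text \<open>Nonsingularity of Cauchy matrices. The numerator polynomial has degree below
  \<open>card Y\<close> but vanishes at the \<open>card S\<close> points \<open>- s - 1\<close>; its
  value at \<open>y\<close> is \<open>c y\<close> times a nonzero product.\<close>

lemma cauchy_system_trivial:
  fixes c :: "real \<Rightarrow> real"
  assumes "finite Y" "card Y \<le> card S" "y \<in> Y"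
    and ne: "\<And>s y. s \<in> S \<Longrightarrow> y \<in> Y \<Longrightarrow> y + s + 1 \<noteq> 0"
    and zero: "\<And>s. s \<in> S \<Longrightarrow> (\<Sum>y\<in>Y. c y / (y + s + 1)) = 0"
  shows "c y = 0"
proof -
  have "node_poly Y c = 0"
  proof (rule poly_eqI_degree)
    fix t assume "t \<in> (\<lambda>s. - s - 1) ` S"
    then obtain s where s: "s \<in> S" "t = - s - 1" by auto
    with ne have "t \<notin> Y" by (force simp: algebra_simps)
    then show "poly (node_poly Y c) t = poly 0 t"
      using zero[OF s(1)] assms(1) by (simp add: poly_node_poly s algebra_simps)
  next
    have "card ((\<lambda>s. - s - 1) ` S) = card S" by (intro card_image) (auto simp: inj_on_def)
    moreover have "degree (node_poly Y c) < card Y" using assms(1,3) by (intro degree_node_poly) auto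
    ultimately show "degree (node_poly Y c) < card ((\<lambda>s. - s - 1) ` S)"
      "degree (0 :: real poly) < card ((\<lambda>s. - s - 1) ` S)"
      using assms(2) by auto
  qed
  then have "c y * (\<Prod>w\<in>Y - {y}. w - y) = 0" using poly_node_poly_node[OF assms(1,3), of c] by simp
  then show ?thesis using assms(1) by auto
qed

lemma pprod_poly:
  assumes "multi_index d v"
  obtains f where "\<And>z. poly f z = pprod d b v z" "int (degree f) = (\<Sum>j = 1..d. v j)"
proof
  define f where "f = (\<Prod>j = 1..d. \<Prod>k<nat (v j). [:b j + 1 + real k, 1:])"
  show "poly f z = pprod d b v z" for z
    unfolding f_def pprod_def poly_prod using assms
    by (intro prod.cong refl)
       (auto simp: multi_index_def ipoch_def pochhammer_prod atLeast0LessThan algebra_simps intro!: prod.cong)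
  have "degree f = (\<Sum>j = 1..d. nat (v j))"
    unfolding f_def by (subst degree_prod_eq_sum_degree; simp)+
  then show "int (degree f) = (\<Sum>j = 1..d. v j)" using assms by (simp add: multi_index_def)
qed

text \<open>Since \<open>x powr (z + \<sigma>)\<close> integrates to
  \<open>1 / (z + \<sigma> + 1)\<close>, the left side is the Mellin transform of the form. It is
  the partial fraction expansion of numerator over denominator at \<open>- \<sigma> - 1\<close>, and
  the inequality between the sums is its degree condition.\<close>

lemma mellin_form:
  assumes "nonint_diffs p a" "multi_index p u" "multi_index q v"
    and "(\<Sum>j = 1..q. v j) < (\<Sum>i = 1..p. u i)"
    and "\<And>z. z \<in> nodes p a u \<Longrightarrow> z + \<sigma> + 1 \<noteq> 0"
  shows "(\<Sum>z\<in>nodes p a u. form_coeff p a u q b v z / (z + \<sigma> + 1)) = zprod q b v \<sigma> / pprod p a u \<sigma>"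
proof -
  obtain f where f: "\<And>z. poly f z = pprod q b v z" "int (degree f) = (\<Sum>j = 1..q. v j)"
    using pprod_poly[OF assms(3)] by blast
  have "(\<Sum>y\<in>nodes p a u. inverse (\<Prod>w\<in>nodes p a u - {y}. w - y) * poly f y / (y - (- \<sigma> - 1))) =
     poly f (- \<sigma> - 1) / (\<Prod>w\<in>nodes p a u. w - (- \<sigma> - 1))"
  proof (rule partial_fractions)
    show "degree f < card (nodes p a u)"
      using f(2) card_nodes_int[OF assms(1,2)] assms(4) by linarith
    show "- \<sigma> - 1 \<notin> nodes p a u" using assms(5)[of "- \<sigma> - 1"] by auto
  qed simp
  then show ?thesis
    by (simp add: form_coeff_def node_weight_def f(1) pprod_eq_prod_nodes[OF assms(1,2)]
        pprod_eq_zprod[of q] algebra_simps)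
qed

section \<open>Sums over nodes\<close>

text \<open>Components outside \<open>{1..d}\<close> stay free: an index path that completes a round
  raises those as well.\<close>

definition step_at :: "nat \<Rightarrow> nat \<Rightarrow> (nat \<Rightarrow> int) \<Rightarrow> (nat \<Rightarrow> int) \<Rightarrow> bool" where
  "step_at d k u u' \<longleftrightarrow> k \<in> {1..d} \<and> u' k = u k + 1 \<and> (\<forall>i\<in>{1..d} - {k}. u' i = u i)"

lemma step_at_le: "step_at d k u u' \<Longrightarrow> i \<in> {1..d} \<Longrightarrow> u i \<le> u' i"
  unfolding step_at_def by (cases "i = k") auto

lemma step_at_sum:
  assumes "step_at d k u u'"
  shows "(\<Sum>i = 1..d. u' i) = (\<Sum>i = 1..d. u i) + 1"
proof -
  have k: "k \<in> {1..d}" using assms by (simp add: step_at_def)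
  have "(\<Sum>i\<in>{1..d} - {k}. u' i) = (\<Sum>i\<in>{1..d} - {k}. u i)"
    using assms by (intro sum.cong) (auto simp: step_at_def)
  then show ?thesis
    using assms unfolding sum.remove[OF finite_atLeastAtMost k] by (simp add: step_at_def)
qed

lemma nodes_step:
  assumes "nonint_diffs d a" "step_at d k u u'" "0 \<le> u k"
  shows "nodes d a u' = insert (a k + of_int (u k)) (nodes d a u)" "a k + of_int (u k) \<notin> nodes d a u"
proof -
  have k: "k \<in> {1..d}" using assms by (simp add: step_at_def)
  show "a k + of_int (u k) \<notin> nodes d a u" using mem_nodes_iff[OF assms(1) k] by simp
  show "nodes d a u' = insert (a k + of_int (u k)) (nodes d a u)"
  proof (intro equalityI subsetI)
    fix z assume "z \<in> nodes d a u'"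
    then obtain i l where il: "i \<in> {1..d}" "int l < u' i" "z = a i + of_int (int l)"
      unfolding nodes_def by auto
    show "z \<in> insert (a k + of_int (u k)) (nodes d a u)"
    proof (cases "int l < u i")
      case True
      then show ?thesis unfolding il(3) using mem_nodes_iff[OF assms(1) il(1), of "int l" u] by simp
    next
      case False
      with il assms(2) have "i = k \<and> int l = u k" by (cases "i = k") (auto simp: step_at_def)
      then show ?thesis unfolding il(3) by simp
    qed
  next
    fix z assume "z \<in> insert (a k + of_int (u k)) (nodes d a u)"
    moreover have "a k + of_int (u k) \<in> nodes d a u'"
      using mem_nodes_iff[OF assms(1) k] assms by (simp add: step_at_def)
    moreover have "nodes d a u \<subseteq> nodes d a u'" by (rule nodes_mono) (rule step_at_le[OF assms(2)])
    ultimately show "z \<in> nodes d a u'" by auto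
  qed
qed

lemma zprod_eq_0_iff:
  assumes "nonint_diffs d a" "multi_index d u"
  shows "zprod d a u z = 0 \<longleftrightarrow> z \<in> nodes d a u"
  unfolding zprod_eq_prod_nodes[OF assms] by auto

lemma node_weight_step_new:
  assumes "nonint_diffs d a" "multi_index d u" "step_at d k u u'"
  shows "node_weight d a u' (a k + of_int (u k)) = inverse (zprod d a u (a k + of_int (u k)))"
proof -
  have "0 \<le> u k" using assms by (auto simp: multi_index_def step_at_def)
  from nodes_step[OF assms(1,3) this] have "nodes d a u' - {a k + of_int (u k)} = nodes d a u" by auto
  then show ?thesis unfolding node_weight_def zprod_eq_prod_nodes[OF assms(1,2)] by simp
qed

text \<open>Each old node acquires one more factor, its distance to the new node. In the middle
  coefficient this becomes \<open>\<alpha> a - \<alpha> k - n k + n a + 1\<close>.\<close>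

lemma node_weight_step_old:
  assumes "nonint_diffs d a" "step_at d k u u'" "0 \<le> u k" "z \<in> nodes d a u"
  shows "node_weight d a u' z = node_weight d a u z / (a k + of_int (u k) - z)"
proof -
  note n = nodes_step[OF assms(1-3)]
  from n assms(4) have "nodes d a u' - {z} = insert (a k + of_int (u k)) (nodes d a u - {z})" by auto
  then have "(\<Prod>w\<in>nodes d a u' - {z}. w - z) = (a k + of_int (u k) - z) * (\<Prod>w\<in>nodes d a u - {z}. w - z)"
    using n(2) by simp
  then show ?thesis unfolding node_weight_def by (simp add: field_simps)
qed

section \<open>Shift rules for Pochhammer products\<close>

lemma ipoch_pos: "0 < x \<Longrightarrow> 0 \<le> k \<Longrightarrow> 0 < ipoch (x :: real) k"
  by (simp add: ipoch_def pochhammer_pos)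

lemma pprod_pos:
  assumes "multi_index d v" "\<And>j. j \<in> {1..d} \<Longrightarrow> 0 < z + b j + 1"
  shows "0 < pprod d b v z"
  unfolding pprod_def using assms by (intro prod_pos ipoch_pos) (auto simp: multi_index_def)

text \<open>The case \<open>k = -1\<close> is included since an index one step below a nonnegative
  one may have this component. Then \<open>ipoch x k\<close> is \<open>1 / (x - 1)\<close>, and the
  side condition says that this is no pole.\<close>

lemma ipoch_succ:
  assumes "0 \<le> k \<or> k = -1 \<and> x + of_int k \<noteq> 0"
  shows "ipoch (x :: real) (k + 1) = ipoch x k * (x + of_int k)"
proof (cases "0 \<le> k")
  case True
  then have "nat (k + 1) = Suc (nat k)" by simp
  with True show ?thesis by (simp add: ipoch_def pochhammer_Suc)
qed (use assms in \<open>auto simp: ipoch_def\<close>)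

lemma pprod_step:
  assumes "step_at d k v v'" "0 \<le> v k \<or> v k = -1 \<and> z + b k + 1 + of_int (v k) \<noteq> 0"
  shows "pprod d b v' z = pprod d b v z * (z + b k + 1 + of_int (v k))"
proof -
  have k: "k \<in> {1..d}" using assms by (simp add: step_at_def)
  have "(\<Prod>j\<in>{1..d} - {k}. ipoch (z + b j + 1) (v' j)) = (\<Prod>j\<in>{1..d} - {k}. ipoch (z + b j + 1) (v j))"
    using assms by (intro prod.cong) (auto simp: step_at_def)
  then show ?thesis
    using assms ipoch_succ[OF assms(2)] unfolding pprod_def prod.remove[OF finite_atLeastAtMost k]
    by (simp add: step_at_def)
qed

lemma ipoch_pred_arg:
  assumes "0 \<le> k"
  shows "ipoch (x - 1 :: real) (k + 1) = (x - 1) * ipoch x k"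
proof -
  from assms have "nat (k + 1) = Suc (nat k)" by simp
  with assms show ?thesis by (simp add: ipoch_def pochhammer_rec)
qed

text \<open>\<open>ipoch (x - 1) (k + 1)\<close> is expanded once at its upper and once at its lower
  end; all inner factors cancel.\<close>

lemma ipoch_shift_ratio:
  assumes "0 \<le> k" "x + of_int k - 1 \<noteq> 0" "ipoch x k \<noteq> 0"
  shows "ipoch (x - 1 :: real) k / ipoch x k = (x - 1) / (x + of_int k - 1)"
proof -
  have "ipoch (x - 1) k * (x - 1 + of_int k) = (x - 1) * ipoch x k"
    using ipoch_succ[of k "x - 1"] ipoch_pred_arg[OF assms(1), of x] assms(1) by simp
  then show ?thesis using assms by (simp add: field_simps)
qed

text \<open>
  At a node \<open>z = a k + l\<close> the factor \<open>zprod d a u' (z + 1)\<close> vanishes unless \<open>l\<close> is the last index of its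
  row and the row is not extended in \<open>u'\<close>.  Rows with \<open>u k = 0\<close> contribute nothing on the left; on the right
  their term is killed by the factor \<open>i = k\<close> of the numerator.
\<close>
lemma shifted_node_sum:
  fixes u u' :: "nat \<Rightarrow> int" and a :: "nat \<Rightarrow> real"
  assumes a: "nonint_diffs d a" and u: "multi_index d u"
    and u': "\<And>i. i \<in> {1..d} \<Longrightarrow> u' i = u i \<or> u' i = u i + 1"
    and K: "K = {k \<in> {1..d}. u' k = u k}"
  shows "(\<Sum>z\<in>nodes d a u. node_weight d a u z * F z * zprod d a u' (z + 1)) =
    (\<Sum>k\<in>K. F (a k + of_int (u k) - 1) *
       ((\<Prod>i = 1..d. a i - a k - of_int (u k)) / (\<Prod>i\<in>K - {k}. a i - a k - of_int (u k) + of_int (u i))))"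
proof -
  define K1 where "K1 = {k \<in> K. 1 \<le> u k}"
  define e where "e = (\<lambda>k. a k + of_int (u k) - 1)"
  have K1: "k \<in> {1..d} \<and> u' k = u k \<and> 1 \<le> u k" if "k \<in> K1" for k using that by (simp add: K1_def K)
  have e_eq: "e k = a k + of_int (u k - 1)" for k by (simp add: e_def)
  have u'0: "multi_index d u'" using u u' by (force simp: multi_index_def)
  have inj: "inj_on e K1"
    using nonint_diffs_eqD[OF a] K1 unfolding e_eq by (intro inj_onI) blast
  have eN: "e k \<in> nodes d a u" if "k \<in> K1" for k
    using K1[OF that] mem_nodes_iff[OF a, of k "u k - 1" u] by (simp add: e_eq)
  have vanish: "zprod d a u' (z + 1) = 0" if "z \<in> nodes d a u - e ` K1" for z
  proof -
    from that obtain i l where il: "i \<in> {1..d}" "int l < u i" "z = a i + of_int (int l)"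
      unfolding nodes_def by auto
    have "int l + 1 < u' i"
    proof (rule ccontr)
      assume "\<not> int l + 1 < u' i"
      with il u'[OF il(1)] have "u' i = u i" "int l = u i - 1" by auto
      with il have "i \<in> K1" "z = e i" by (auto simp: K1_def K e_eq)
      with that show False by blast
    qed
    then have "a i + of_int (int l + 1) \<in> nodes d a u'"
      using mem_nodes_iff[OF a il(1), of "int l + 1" u'] by simp
    moreover have "a i + of_int (int l + 1) = z + 1" using il by simp
    ultimately show ?thesis using zprod_eq_0_iff[OF a u'0] by metis
  qed
  have ratio: "node_weight d a u (e k) * zprod d a u' (e k + 1) =
      (\<Prod>i = 1..d. a i - a k - of_int (u k)) / (\<Prod>i\<in>K - {k}. a i - a k - of_int (u k) + of_int (u i))"
    if k: "k \<in> K1" for k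
  proof -
    have kd: "k \<in> {1..d}" "u' k = u k" "1 \<le> u k" using K1[OF k] by auto
    \<comment> \<open>As \<open>e k\<close> is the last node of its row, removing it leaves the
      nodes of a multi-index, and the weight of \<open>e k\<close> is the reciprocal of a
      \<open>zprod\<close>.\<close>
    define um where "um = u(k := u k - 1)"
    have um: "multi_index d um" using u kd by (auto simp: um_def multi_index_def)
    have "step_at d k um u" using kd by (auto simp: um_def step_at_def)
    from node_weight_step_new[OF a um this]
    have nw: "node_weight d a u (e k) = inverse (zprod d a um (e k))"
      by (simp add: um_def e_def algebra_simps)
    define G where "G = (\<lambda>i. ipoch (a i - e k - 1) (u' i) / ipoch (a i - e k) (um i))"
    have "node_weight d a u (e k) * zprod d a u' (e k + 1) = zprod d a u' (e k + 1) / zprod d a um (e k)"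
      unfolding nw by (simp add: field_simps)
    also have "\<dots> = (\<Prod>i = 1..d. G i)"
      unfolding zprod_def G_def prod_dividef by (simp add: algebra_simps)
    also have "\<dots> = (\<Prod>i = 1..d. (a i - a k - of_int (u k)) /
        (if i \<in> K - {k} then a i - a k - of_int (u k) + of_int (u i) else 1))"
    proof (rule prod.cong[OF refl])
      fix i assume i: "i \<in> {1..d}"
      have eq: "a i - e k - 1 = a i - a k - of_int (u k)" by (simp add: e_def)
      have um0: "0 \<le> um i" and u0: "0 \<le> u i" using um u i by (auto simp: multi_index_def)
      have "zprod d a um (e k) \<noteq> 0"
        using zprod_eq_0_iff[OF a um] mem_nodes_iff[OF a kd(1), of "u k - 1" um]
        by (simp add: e_eq um_def del: of_int_diff)
      then have nz: "ipoch (a i - e k) (um i) \<noteq> 0" using i by (simp add: zprod_def)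
      show "G i = (a i - a k - of_int (u k)) /
        (if i \<in> K - {k} then a i - a k - of_int (u k) + of_int (u i) else 1)"
      proof (cases "i \<in> K - {k}")
        case True
        then have i': "u' i = u i" "um i = u i" "i \<noteq> k" by (auto simp: K um_def)
        have "a i - e k + of_int (u i) - 1 \<noteq> 0"
          using nonint_diffs_eqD[OF a i kd(1), of "u i" "u k"] i' by (auto simp: e_def)
        from ipoch_shift_ratio[OF u0 this] nz True show ?thesis
          unfolding G_def i' by (simp add: e_def algebra_simps)
      next
        case False
        \<comment> \<open>Either \<open>i = k\<close>, where \<open>um\<close> was lowered, or row
          \<open>i\<close> is extended in \<open>u'\<close>; both times the quotient is a single
          factor.\<close>
        have "u' i = um i + 1" using False i u'[OF i] kd by (cases "i = k") (auto simp: K um_def)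
        then have "G i = a i - e k - 1"
          unfolding G_def using ipoch_pred_arg[OF um0, of "a i - e k"] nz by simp
        then show ?thesis unfolding if_not_P[OF False] eq by simp
      qed
    qed
    also have "\<dots> = (\<Prod>i = 1..d. a i - a k - of_int (u k)) /
        (\<Prod>i = 1..d. if i \<in> K - {k} then a i - a k - of_int (u k) + of_int (u i) else 1)"
      by (rule prod_dividef)
    also have "(\<Prod>i = 1..d. if i \<in> K - {k} then a i - a k - of_int (u k) + of_int (u i) else 1) =
       (\<Prod>i\<in>K - {k}. a i - a k - of_int (u k) + of_int (u i))"
      by (rule prod.mono_neutral_cong_right) (auto simp: K)
    finally show ?thesis .
  qed
  have "(\<Sum>z\<in>nodes d a u. node_weight d a u z * F z * zprod d a u' (z + 1)) =
        (\<Sum>z\<in>e ` K1. node_weight d a u z * F z * zprod d a u' (z + 1))"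
    using eN vanish by (intro sum.mono_neutral_right) auto
  also have "\<dots> = (\<Sum>k\<in>K1. F (e k) * (node_weight d a u (e k) * zprod d a u' (e k + 1)))"
    by (subst sum.reindex[OF inj]) (simp add: algebra_simps)
  also have "\<dots> = (\<Sum>k\<in>K1. F (a k + of_int (u k) - 1) *
       ((\<Prod>i = 1..d. a i - a k - of_int (u k)) / (\<Prod>i\<in>K - {k}. a i - a k - of_int (u k) + of_int (u i))))"
    by (intro sum.cong refl) (simp only: ratio, simp only: e_def)
  also have "\<dots> = (\<Sum>k\<in>K. F (a k + of_int (u k) - 1) *
       ((\<Prod>i = 1..d. a i - a k - of_int (u k)) / (\<Prod>i\<in>K - {k}. a i - a k - of_int (u k) + of_int (u i))))"
  proof (rule sum.mono_neutral_left)
    show "\<forall>k\<in>K - K1. F (a k + of_int (u k) - 1) *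
       ((\<Prod>i = 1..d. a i - a k - of_int (u k)) / (\<Prod>i\<in>K - {k}. a i - a k - of_int (u k) + of_int (u i))) = 0"
    proof
      fix k assume k: "k \<in> K - K1"
      with u have "u k = 0" by (force simp: K1_def K multi_index_def)
      then have "(\<Prod>i = 1..d. a i - a k - of_int (u k)) = 0" using k by (auto simp: K)
      then show "F (a k + of_int (u k) - 1) *
       ((\<Prod>i = 1..d. a i - a k - of_int (u k)) / (\<Prod>i\<in>K - {k}. a i - a k - of_int (u k) + of_int (u i))) = 0" by simp
    qed
  qed (auto simp: K1_def K)
  finally show ?thesis .
qed

section \<open>Pairings of the two kinds of forms\<close>

locale pineiro_system =
  fixes p q :: nat and \<alpha> \<beta> :: "nat \<Rightarrow> real"
  assumes alpha_beta: "\<And>i j. i \<in> {1..p} \<Longrightarrow> j \<in> {1..q} \<Longrightarrow> \<alpha> i + \<beta> j > - 1"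
    and nonint_alpha: "nonint_diffs p \<alpha>"
    and nonint_beta: "nonint_diffs q \<beta>"
begin

abbreviation "A \<equiv> pineiro_A p q \<alpha> \<beta>"
abbreviation "B \<equiv> pineiro_B p q \<alpha> \<beta>"
abbreviation "sepA \<equiv> separated_A p q \<alpha> \<beta>"
abbreviation "cA \<equiv> \<lambda>u v. form_coeff p \<alpha> u q \<beta> v"
abbreviation "cB \<equiv> \<lambda>u v. form_coeff q \<beta> v p \<alpha> u"

lemma node_beta: "z \<in> nodes p \<alpha> u \<Longrightarrow> j \<in> {1..q} \<Longrightarrow> z + \<beta> j + 1 > 0"
  using alpha_beta unfolding nodes_def by fastforce

lemma node_node:
  assumes "z \<in> nodes p \<alpha> u" "y \<in> nodes q \<beta> v"
  shows "z + y > -1"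
proof -
  obtain j k where "j \<in> {1..q}" "y = \<beta> j + real k" using assms(2) unfolding nodes_def by blast
  with node_beta[OF assms(1), of j] show ?thesis by simp
qed

lemma sepA_nonneg: "multi_index q v \<Longrightarrow> sepA u v"
  unfolding separated_A_def other_poles_def multi_index_def by fastforce

lemma A_eq:
  assumes "multi_index p u" "sepA u v"
  shows "A u v = (\<lambda>x. of_real (power_sum (nodes p \<alpha> u) (cA u v) x))"
  using contour_form_eq_sum[OF nonint_alpha assms(1), of q \<beta> v] assms(2)
  unfolding pineiro_A_def separated_A_def power_sum_def by blast

lemma B_eq:
  assumes "multi_index p u" "multi_index q v"
  shows "B u v = (\<lambda>x. of_real (power_sum (nodes q \<beta> v) (cB u v) x))"
proof -
  have "other_poles p \<alpha> u = {}" using assms(1) unfolding other_poles_def multi_index_def by fastforce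
  then show ?thesis
    using contour_form_eq_sum[OF nonint_beta assms(2), of p \<alpha> u]
    unfolding pineiro_B_def power_sum_def by auto
qed

text \<open>The shift \<open>e\<close> is 0 for the plain pairing and 1 for the pairing with the
  extra factor \<open>x\<close>.\<close>

lemma mellin_B:
  assumes "multi_index p n" "multi_index q m" "(\<Sum>j = 1..q. m j) = (\<Sum>i = 1..p. n i) + 1"
    and "z \<in> nodes p \<alpha> u" "0 \<le> e"
  shows "(\<Sum>y\<in>nodes q \<beta> m. cB n m y / (y + (z + e) + 1)) = zprod p \<alpha> n (z + e) / pprod q \<beta> m (z + e)"
proof (rule mellin_form)
  fix y assume "y \<in> nodes q \<beta> m"
  from node_node[OF assms(4) this] assms(5) show "y + (z + e) + 1 \<noteq> 0" by simp
qed (use assms nonint_beta in auto)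

lemma mellin_A:
  assumes "multi_index p u" "multi_index q v" "(\<Sum>i = 1..p. u i) = (\<Sum>j = 1..q. v j) + 1"
    and "y \<in> nodes q \<beta> m" "0 \<le> e"
  shows "(\<Sum>z\<in>nodes p \<alpha> u. cA u v z / (z + (y + e) + 1)) = zprod q \<beta> v (y + e) / pprod p \<alpha> u (y + e)"
proof (rule mellin_form)
  fix z assume "z \<in> nodes p \<alpha> u"
  from node_node[OF this assms(4)] assms(5) show "z + (y + e) + 1 \<noteq> 0" by simp
qed (use assms nonint_alpha in auto)

context
  fixes n m u v
  assumes n: "multi_index p n" and m: "multi_index q m"
    and sum_m: "(\<Sum>j = 1..q. m j) = (\<Sum>i = 1..p. n i) + 1"
    and u: "multi_index p u" and sep: "sepA u v"
begin

text \<open>Integrating against each power in \<open>A\<close> separately turns \<open>B\<close>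
  into its Mellin transform. The numerator of \<open>A\<close> enters only through the coefficients,
  so \<open>v\<close> may have a component -1 as long as the poles are separated.\<close>

lemma pairing_A_B:
  "pairing (A u v) (B n m) = of_real (\<Sum>z\<in>nodes p \<alpha> u. cA u v z * (zprod p \<alpha> n z / pprod q \<beta> m z))"
proof -
  have "pairing (A u v) (B n m) =
     of_real (\<Sum>z\<in>nodes p \<alpha> u. \<Sum>y\<in>nodes q \<beta> m. cA u v z * cB n m y / (z + y + 1))"
    unfolding A_eq[OF u sep] B_eq[OF n m] by (rule pairing_power_sum[OF node_node])
  also have "(\<Sum>z\<in>nodes p \<alpha> u. \<Sum>y\<in>nodes q \<beta> m. cA u v z * cB n m y / (z + y + 1)) =
     (\<Sum>z\<in>nodes p \<alpha> u. cA u v z * (\<Sum>y\<in>nodes q \<beta> m. cB n m y / (y + (z + 0) + 1)))"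
    by (simp add: sum_distrib_left algebra_simps)
  also have "\<dots> = (\<Sum>z\<in>nodes p \<alpha> u. cA u v z * (zprod p \<alpha> n z / pprod q \<beta> m z))"
    by (intro sum.cong refl, subst mellin_B[OF n m sum_m]) simp_all
  finally show ?thesis .
qed

lemma xpairing_A_B:
  "xpairing (A u v) (B n m) =
     of_real (\<Sum>z\<in>nodes p \<alpha> u. cA u v z * (zprod p \<alpha> n (z + 1) / pprod q \<beta> m (z + 1)))"
proof -
  have "xpairing (A u v) (B n m) =
     of_real (\<Sum>z\<in>nodes p \<alpha> u. \<Sum>y\<in>nodes q \<beta> m. cA u v z * cB n m y / (z + y + 2))"
    unfolding A_eq[OF u sep] B_eq[OF n m] by (rule xpairing_power_sum[OF node_node])
  also have "(\<Sum>z\<in>nodes p \<alpha> u. \<Sum>y\<in>nodes q \<beta> m. cA u v z * cB n m y / (z + y + 2)) =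
     (\<Sum>z\<in>nodes p \<alpha> u. cA u v z * (\<Sum>y\<in>nodes q \<beta> m. cB n m y / (y + (z + 1) + 1)))"
    by (simp add: sum_distrib_left algebra_simps)
  also have "\<dots> = (\<Sum>z\<in>nodes p \<alpha> u. cA u v z * (zprod p \<alpha> n (z + 1) / pprod q \<beta> m (z + 1)))"
    by (intro sum.cong refl, subst mellin_B[OF n m sum_m]) simp_all
  finally show ?thesis .
qed

context
  assumes v: "multi_index q v" and sum_u: "(\<Sum>i = 1..p. u i) = (\<Sum>j = 1..q. v j) + 1"
begin

text \<open>Here \<open>A\<close> is replaced by its transform and the powers of \<open>B\<close>
  remain. This requires a polynomial numerator of smaller degree than the denominator, hence the two
  assumptions of the inner context.\<close>

lemma pairing_A_B':
  "pairing (A u v) (B n m) = of_real (\<Sum>y\<in>nodes q \<beta> m. cB n m y * (zprod q \<beta> v y / pprod p \<alpha> u y))"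
proof -
  have "pairing (A u v) (B n m) =
     of_real (\<Sum>z\<in>nodes p \<alpha> u. \<Sum>y\<in>nodes q \<beta> m. cA u v z * cB n m y / (z + y + 1))"
    unfolding A_eq[OF u sep] B_eq[OF n m] by (rule pairing_power_sum[OF node_node])
  also have "(\<Sum>z\<in>nodes p \<alpha> u. \<Sum>y\<in>nodes q \<beta> m. cA u v z * cB n m y / (z + y + 1)) =
     (\<Sum>y\<in>nodes q \<beta> m. cB n m y * (\<Sum>z\<in>nodes p \<alpha> u. cA u v z / (z + (y + 0) + 1)))"
    by (subst sum.swap) (simp add: sum_distrib_left algebra_simps)
  also have "\<dots> = (\<Sum>y\<in>nodes q \<beta> m. cB n m y * (zprod q \<beta> v y / pprod p \<alpha> u y))"
    by (intro sum.cong refl, subst mellin_A[OF u v sum_u]) simp_all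
  finally show ?thesis .
qed

lemma xpairing_A_B':
  "xpairing (A u v) (B n m) =
     of_real (\<Sum>y\<in>nodes q \<beta> m. cB n m y * (zprod q \<beta> v (y + 1) / pprod p \<alpha> u (y + 1)))"
proof -
  have "xpairing (A u v) (B n m) =
     of_real (\<Sum>z\<in>nodes p \<alpha> u. \<Sum>y\<in>nodes q \<beta> m. cA u v z * cB n m y / (z + y + 2))"
    unfolding A_eq[OF u sep] B_eq[OF n m] by (rule xpairing_power_sum[OF node_node])
  also have "(\<Sum>z\<in>nodes p \<alpha> u. \<Sum>y\<in>nodes q \<beta> m. cA u v z * cB n m y / (z + y + 2)) =
     (\<Sum>y\<in>nodes q \<beta> m. cB n m y * (\<Sum>z\<in>nodes p \<alpha> u. cA u v z / (z + (y + 1) + 1)))"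
    by (subst sum.swap) (simp add: sum_distrib_left algebra_simps)
  also have "\<dots> = (\<Sum>y\<in>nodes q \<beta> m. cB n m y * (zprod q \<beta> v (y + 1) / pprod p \<alpha> u (y + 1)))"
    by (intro sum.cong refl, subst mellin_A[OF u v sum_u]) simp_all
  finally show ?thesis .
qed

end

end

text \<open>If \<open>v b = -1\<close>, the new factor is \<open>z + \<beta> b\<close>, nonzero
  because separation keeps \<open>z\<close> away from the pole \<open>- \<beta> b\<close>.
  Multiplied by this factor, \<open>pprod q \<beta> v z\<close> becomes the positive number
  \<open>pprod q \<beta> v' z\<close>, so it is nonzero itself.\<close>

lemma separated_node:
  assumes "step_at q b v v'" "multi_index q v'" "sepA u v" "z \<in> nodes p \<alpha> u"
  shows "0 \<le> v b \<or> v b = -1 \<and> z + \<beta> b + 1 + of_int (v b) \<noteq> 0"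
    and "z + \<beta> b + 1 + of_int (v b) \<noteq> 0"
    and "pprod q \<beta> v z \<noteq> 0"
    and "pprod q \<beta> v' z = pprod q \<beta> v z * (z + \<beta> b + 1 + of_int (v b))"
proof -
  have b: "b \<in> {1..q}" using assms by (simp add: step_at_def)
  have "0 \<le> v' b" using assms b by (auto simp: multi_index_def)
  then have vb: "v b \<ge> -1" using assms by (simp add: step_at_def)
  have zb: "z + \<beta> b + 1 > 0" using node_beta[OF assms(4) b] .
  show ne: "z + \<beta> b + 1 + of_int (v b) \<noteq> 0"
  proof (cases "0 \<le> v b")
    case False
    with vb have vb: "v b = -1" by simp
    have "complex_of_real (real 0 - \<beta> b) \<in> other_poles q \<beta> v"
      unfolding other_poles_def using b vb by (intro CollectI exI[of _ b] exI[of _ 0]) auto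
    moreover have "complex_of_real z \<in> enclosed_poles p \<alpha> u"
      unfolding enclosed_poles_eq_image using assms(4) by blast
    ultimately have "complex_of_real z \<noteq> complex_of_real (real 0 - \<beta> b)"
      using assms(3) unfolding separated_A_def by (metis disjoint_iff)
    then have "z \<noteq> - \<beta> b" by auto
    then show ?thesis using vb by auto
  qed (use zb in auto)
  then show or: "0 \<le> v b \<or> v b = -1 \<and> z + \<beta> b + 1 + of_int (v b) \<noteq> 0" using vb by auto
  show st: "pprod q \<beta> v' z = pprod q \<beta> v z * (z + \<beta> b + 1 + of_int (v b))"
    using pprod_step[OF assms(1), of z \<beta>] or by blast
  have "pprod q \<beta> v' z > 0" by (rule pprod_pos[OF assms(2) node_beta[OF assms(4)]])
  then show "pprod q \<beta> v z \<noteq> 0" using st by auto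
qed

text \<open>The transform of \<open>B\<close> vanishes at every node of \<open>u'\<close> except the
  new one \<open>z\<close>, where \<open>zprod\<close> cancels against the node weight. What remains
  is a quotient of numerators that differ by one step.\<close>

lemma pairing_dual:
  assumes "step_at p a u u'" "step_at q b v v'" "multi_index p u" "multi_index q v'" "sepA u' v"
    and "(\<Sum>j = 1..q. v' j) = (\<Sum>i = 1..p. u i) + 1"
  defines "z \<equiv> \<alpha> a + of_int (u a)"
  shows "pairing (A u' v) (B u v') = of_real (pprod q \<beta> v z / pprod q \<beta> v' z)"
    and "z \<in> nodes p \<alpha> u'"
    and "pprod q \<beta> v z / pprod q \<beta> v' z = 1 / (z + \<beta> b + 1 + of_int (v b))"
    and "z + \<beta> b + 1 + of_int (v b) \<noteq> 0"
    and "pprod q \<beta> v z \<noteq> 0"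
proof -
  have ua: "0 \<le> u a" using assms by (auto simp: step_at_def multi_index_def)
  have u': "multi_index p u'" using step_at_le[OF assms(1)] assms(3) by (force simp: multi_index_def)
  note ns = nodes_step[OF nonint_alpha assms(1) ua, folded z_def]
  show z: "z \<in> nodes p \<alpha> u'" using ns by simp
  note sn = separated_node[OF assms(2,4,5) z]
  show ne: "z + \<beta> b + 1 + of_int (v b) \<noteq> 0" "pprod q \<beta> v z \<noteq> 0" using sn by auto
  show "pprod q \<beta> v z / pprod q \<beta> v' z = 1 / (z + \<beta> b + 1 + of_int (v b))" using sn by simp
  have nz: "zprod p \<alpha> u z \<noteq> 0" using zprod_eq_0_iff[OF nonint_alpha assms(3)] ns(2) by simp
  have "(\<Sum>w\<in>nodes p \<alpha> u'. cA u' v w * (zprod p \<alpha> u w / pprod q \<beta> v' w)) =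
        (\<Sum>w\<in>{z}. cA u' v w * (zprod p \<alpha> u w / pprod q \<beta> v' w))"
    using zprod_eq_0_iff[OF nonint_alpha assms(3)] ns by (intro sum.mono_neutral_right) auto
  also have "\<dots> = pprod q \<beta> v z / pprod q \<beta> v' z"
    using nz node_weight_step_new[OF nonint_alpha assms(3,1)] by (simp add: form_coeff_def flip: z_def)
  finally show "pairing (A u' v) (B u v') = of_real (pprod q \<beta> v z / pprod q \<beta> v' z)"
    using pairing_A_B[OF assms(3,4,6) u' assms(5)] by simp
qed

text \<open>Orthogonality read off at the poles of \<open>A\<close>: each is a zero of the transform
  of \<open>B\<close>. As \<open>v\<close> is arbitrary, this serves the lowest dual form,
  too.\<close>

lemma pairing_zero_left:
  assumes "multi_index p n" "\<And>i. i \<in> {1..p} \<Longrightarrow> u i \<le> n i"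
  shows "(\<Sum>z\<in>nodes p \<alpha> u. cA u v z * (zprod p \<alpha> n z / pprod q \<beta> m z)) = 0"
proof (rule sum.neutral, rule ballI)
  fix z assume "z \<in> nodes p \<alpha> u"
  with nodes_mono[of p u n \<alpha>] assms(2) have "z \<in> nodes p \<alpha> n" by blast
  then show "cA u v z * (zprod p \<alpha> n z / pprod q \<beta> m z) = 0"
    using zprod_eq_0_iff[OF nonint_alpha assms(1)] by simp
qed

text \<open>Here \<open>u\<close> may exceed \<open>n\<close>, and single terms need not vanish. The
  sum is the pairing, which can be rewritten over the poles of \<open>B\<close>; all of these are
  zeros of the transform of \<open>A\<close>.\<close>

lemma pairing_zero_right:
  assumes "multi_index p n" "multi_index q m" "(\<Sum>j = 1..q. m j) = (\<Sum>i = 1..p. n i) + 1"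
    and "multi_index p u" "\<And>j. j \<in> {1..q} \<Longrightarrow> m j \<le> v j" "(\<Sum>i = 1..p. u i) = (\<Sum>j = 1..q. v j) + 1"
  shows "(\<Sum>z\<in>nodes p \<alpha> u. cA u v z * (zprod p \<alpha> n z / pprod q \<beta> m z)) = 0"
proof -
  have v: "multi_index q v" using assms(2,5) by (force simp: multi_index_def)
  note h = assms(1-4) sepA_nonneg[OF v]
  have "(\<Sum>y\<in>nodes q \<beta> m. cB n m y * (zprod q \<beta> v y / pprod p \<alpha> u y)) = 0"
  proof (rule sum.neutral, rule ballI)
    fix y assume "y \<in> nodes q \<beta> m"
    with nodes_mono[of q m v \<beta>] assms(5) have "y \<in> nodes q \<beta> v" by blast
    then show "cB n m y * (zprod q \<beta> v y / pprod p \<alpha> u y) = 0"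
      using zprod_eq_0_iff[OF nonint_beta v] by simp
  qed
  then show ?thesis
    using pairing_A_B[OF h] pairing_A_B'[OF h v assms(6)] by (metis of_real_eq_iff)
qed

end

section \<open>The recurrence relation\<close>

lemma sum_extend_zero:
  fixes c g :: "real \<Rightarrow> real"
  assumes "finite T" "Y \<subseteq> T"
  shows "(\<Sum>y\<in>T. (if y \<in> Y then c y else 0) * g y) = (\<Sum>y\<in>Y. c y * g y)"
  using assms by (intro sum.mono_neutral_cong_right) auto

lemma sum_extend_zero_shift:
  fixes c g :: "real \<Rightarrow> real"
  assumes "finite T" "\<And>y. y \<in> Y \<Longrightarrow> y + 1 \<in> T"
  shows "(\<Sum>y\<in>T. (if y - 1 \<in> Y then c (y - 1) else 0) * g y) = (\<Sum>y\<in>Y. c y * g (y + 1))"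
proof -
  have img: "y \<in> (\<lambda>y. y + 1) ` Y \<longleftrightarrow> y - 1 \<in> Y" for y
    by (metis (no_types, lifting) add_diff_cancel_right' diff_add_cancel image_iff)
  have "(\<Sum>y\<in>T. (if y - 1 \<in> Y then c (y - 1) else 0) * g y) =
        (\<Sum>y\<in>(\<lambda>y. y + 1) ` Y. c (y - 1) * g y)"
    using assms by (intro sum.mono_neutral_cong_right) (auto simp: img)
  also have "\<dots> = (\<Sum>y\<in>Y. c y * g (y + 1))" by (subst sum.reindex) auto
  finally show ?thesis .
qed

lemma chain_mono:
  fixes N :: "int \<Rightarrow> nat \<Rightarrow> int"
  assumes "\<And>l. l \<in> {L..<H} \<Longrightarrow> \<exists>a. step_at d a (N l) (N (l + 1))"
    and "L \<le> l" "l \<le> l'" "l' \<le> H" "i \<in> {1..d}"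
  shows "N l i \<le> N l' i"
  using assms(3,4)
proof (induction l' rule: int_ge_induct)
  case (step k)
  then have "k \<in> {L..<H}" using assms(2) by auto
  with assms(1) obtain a where "step_at d a (N k) (N (k + 1))" by blast
  from step_at_le[OF this assms(5)] step show ?case by simp
qed simp

context pineiro_system
begin

text \<open>\<open>low\<close> and \<open>high\<close> control the shift of exponents by the factor
  \<open>x\<close>: by \<open>low\<close>, \<open>z + 1\<close> is a node of \<open>N 0\<close> for
  every node \<open>z\<close> of \<open>N L\<close>; by \<open>high\<close>, \<open>y + 1\<close> is
  a node of \<open>M H\<close> for every node \<open>y\<close> of \<open>M 0\<close>. Separation is
  demanded at \<open>L\<close> alone because \<open>M (l - 1)\<close> is nonnegative for all larger
  \<open>l\<close>.\<close>

lemma chain_recurrence: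
  fixes L H :: int and N M :: "int \<Rightarrow> nat \<Rightarrow> int"
  assumes LH: "L \<le> 0" "0 \<le> H"
    and stepN: "\<And>l. l \<in> {L..H} \<Longrightarrow> \<exists>a. step_at p a (N l) (N (l + 1))"
    and stepM: "\<And>l. l \<in> {L..H} \<Longrightarrow> \<exists>b. step_at q b (M (l - 1)) (M l)"
    and startN: "multi_index p (N L)" and startM: "multi_index q (M L)"
    and total: "(\<Sum>j = 1..q. M 0 j) = (\<Sum>i = 1..p. N 0 i) + 1"
    and sep: "sepA (N (L + 1)) (M (L - 1))"
    and low: "\<And>i. i \<in> {1..p} \<Longrightarrow> 0 < N L i \<Longrightarrow> N L i < N 0 i"
    and high: "\<And>j. j \<in> {1..q} \<Longrightarrow> M 0 j < M H j"
    and c: "\<And>l. l \<in> {L..H} \<Longrightarrow> c l = xpairing (A (N (l + 1)) (M (l - 1))) (B (N 0) (M 0))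
                               / pairing (A (N (l + 1)) (M (l - 1))) (B (N l) (M l))"
    and x: "0 < x"
  shows "of_real x * B (N 0) (M 0) x = (\<Sum>l\<in>{L..H}. c l * B (N l) (M l) x)"
proof -
  have monoN: "N l i \<le> N l' i" if "L \<le> l" "l \<le> l'" "l' \<le> H + 1" "i \<in> {1..p}" for l l' i
    by (rule chain_mono[where L = L and H = "H + 1" and d = p and N = N]) (use that stepN in auto)
  have monoM: "M l j \<le> M l' j" if "L - 1 \<le> l" "l \<le> l'" "l' \<le> H" "j \<in> {1..q}" for l l' j
  proof (rule chain_mono[where L = "L - 1" and H = H and d = q and N = M])
    fix k assume "k \<in> {L - 1..<H}"
    then show "\<exists>b. step_at q b (M k) (M (k + 1))" using stepM[of "k + 1"] by simp
  qed (use that in auto)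
  have N0: "multi_index p (N l)" if "L \<le> l" "l \<le> H + 1" for l
    unfolding multi_index_def
  proof
    fix i assume i: "i \<in> {1..p}"
    with startN have "0 \<le> N L i" by (simp add: multi_index_def)
    also have "\<dots> \<le> N l i" using that i by (intro monoN) auto
    finally show "0 \<le> N l i" .
  qed
  have M0: "multi_index q (M l)" if "L \<le> l" "l \<le> H" for l
    unfolding multi_index_def
  proof
    fix j assume j: "j \<in> {1..q}"
    with startM have "0 \<le> M L j" by (simp add: multi_index_def)
    also have "\<dots> \<le> M l j" using that j by (intro monoM) auto
    finally show "0 \<le> M l j" .
  qed
  have sumN: "(\<Sum>i = 1..p. N (l + 1) i) = (\<Sum>i = 1..p. N l i) + 1" if "l \<in> {L..H}" for l
    using stepN[OF that] step_at_sum by blast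
  have sumM: "(\<Sum>j = 1..q. M l j) = (\<Sum>j = 1..q. M (l - 1) j) + 1" if "l \<in> {L..H}" for l
    using stepM[OF that] step_at_sum by blast
  \<comment> \<open>The balance between \<open>M\<close> and \<open>N\<close> is given at 0 but
    needed at every level; each step raises both totals by one.\<close>
  have gap: "l \<le> H \<longrightarrow> (\<Sum>j = 1..q. M l j) - (\<Sum>i = 1..p. N l i) = (\<Sum>j = 1..q. M L j) - (\<Sum>i = 1..p. N L i)"
    if "L \<le> l" for l
    using that
  proof (induction l rule: int_ge_induct)
    case (step k)
    then show ?case using sumN[of k] sumM[of "k + 1"] by auto
  qed simp
  have sums: "(\<Sum>j = 1..q. M l j) = (\<Sum>i = 1..p. N l i) + 1" if "l \<in> {L..H}" for l
    using gap[of l] gap[of 0] that LH total by auto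
  have sums': "(\<Sum>i = 1..p. N (l + 1) i) = (\<Sum>j = 1..q. M (l - 1) j) + 1" if "l \<in> {L..H}" for l
    using sums[OF that] sumM[OF that] sumN[OF that] by simp
  have sepl: "sepA (N (l + 1)) (M (l - 1))" if "l \<in> {L..H}" for l
  proof (cases "l = L")
    case False
    with that show ?thesis by (intro sepA_nonneg M0) auto
  qed (use sep in simp)

  \<comment> \<open>\<open>\<phi> l\<close> and \<open>W\<close> are the Mellin transforms of
    \<open>B (N l) (M l)\<close> and of \<open>x\<close> times \<open>B (N 0) (M 0)\<close>;
    \<open>\<Lambda> l\<close> turns a transform into the integral against the dual form of level
    \<open>l\<close>.\<close>
  define \<phi> where "\<phi> = (\<lambda>l z. zprod p \<alpha> (N l) z / pprod q \<beta> (M l) z)"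
  define W where "W = (\<lambda>z. zprod p \<alpha> (N 0) (z + 1) / pprod q \<beta> (M 0) (z + 1))"
  define \<Lambda> where "\<Lambda> = (\<lambda>l f. \<Sum>z\<in>nodes p \<alpha> (N (l + 1)). cA (N (l + 1)) (M (l - 1)) z * f z)"
  define r where "r = (\<lambda>l. \<Lambda> l W / \<Lambda> l (\<phi> l))"
  define D where "D = (\<lambda>z. W z - (\<Sum>l\<in>{L..H}. r l * \<phi> l z))"

  have pair: "pairing (A (N (l + 1)) (M (l - 1))) (B (N l) (M l)) = of_real (\<Lambda> l (\<phi> l))" if "l \<in> {L..H}" for l
    unfolding \<Lambda>_def \<phi>_def using that
    by (intro pairing_A_B N0 M0 sums sepl) auto
  have xpair: "xpairing (A (N (l + 1)) (M (l - 1))) (B (N 0) (M 0)) = of_real (\<Lambda> l W)" if "l \<in> {L..H}" for l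
    unfolding \<Lambda>_def W_def using that LH
    by (intro xpairing_A_B N0 M0 sums sepl) auto
  have cr: "c l = of_real (r l)" if "l \<in> {L..H}" for l
    using c[OF that] pair[OF that] xpair[OF that] by (simp add: r_def)

  have diag: "\<Lambda> l (\<phi> l) \<noteq> 0" if l: "l \<in> {L..H}" for l
  proof -
    obtain a b where ab: "step_at p a (N l) (N (l + 1))" "step_at q b (M (l - 1)) (M l)"
      using stepN[OF l] stepM[OF l] by blast
    have h: "multi_index p (N l)" "multi_index q (M l)" using l by (auto intro: N0 M0)
    note pd = pairing_dual[OF ab h sepl[OF l] sums[OF l]]
    have "of_real (\<Lambda> l (\<phi> l)) \<noteq> (0 :: complex)"
      unfolding pair[OF l, symmetric] pd(1) of_real_eq_0_iff pd(3) using pd(4) by simp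
    then show ?thesis by simp
  qed
  have offdiag: "\<Lambda> l (\<phi> k) = 0" if l: "l \<in> {L..H}" and k: "k \<in> {L..H}" and "k \<noteq> l" for l k
  proof (cases "l < k")
    case True
    show ?thesis unfolding \<Lambda>_def \<phi>_def
      by (rule pairing_zero_left) (use l k True in \<open>auto intro!: N0 monoN\<close>)
  next
    \<comment> \<open>Now \<open>M k \<le> M (l - 1)\<close>, so the numerator of the dual form is a
      polynomial. Level \<open>l = L\<close>, where it may fail to be one, always falls under the
      first case.\<close>
    case False
    with \<open>k \<noteq> l\<close> have "k < l" by simp
    then show ?thesis unfolding \<Lambda>_def \<phi>_def
      by (intro pairing_zero_right) (use l k sums[OF k] sums'[OF l] in \<open>auto intro!: N0 M0 monoM\<close>)
  qed
  have \<Lambda>D: "\<Lambda> l D = 0" if l: "l \<in> {L..H}" for l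
  proof -
    have "\<Lambda> l D = \<Lambda> l W - (\<Sum>k\<in>{L..H}. r k * \<Lambda> l (\<phi> k))"
    proof -
      have "\<Lambda> l D = \<Lambda> l W - (\<Sum>z\<in>nodes p \<alpha> (N (l + 1)). \<Sum>k\<in>{L..H}. r k * (cA (N (l + 1)) (M (l - 1)) z * \<phi> k z))"
        unfolding \<Lambda>_def D_def right_diff_distrib sum_subtractf sum_distrib_left
        by (simp add: mult.left_commute)
      also have "(\<Sum>z\<in>nodes p \<alpha> (N (l + 1)). \<Sum>k\<in>{L..H}. r k * (cA (N (l + 1)) (M (l - 1)) z * \<phi> k z)) =
         (\<Sum>k\<in>{L..H}. r k * \<Lambda> l (\<phi> k))"
        unfolding \<Lambda>_def by (subst sum.swap) (simp add: sum_distrib_left)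
      finally show ?thesis .
    qed
    also have "(\<Sum>k\<in>{L..H}. r k * \<Lambda> l (\<phi> k)) = (\<Sum>k\<in>{l}. r k * \<Lambda> l (\<phi> k))"
      using l offdiag[OF l] by (intro sum.mono_neutral_right) auto
    finally show ?thesis using diag[OF l] by (simp add: r_def)
  qed

  \<comment> \<open>\<open>N (l + 1)\<close> has exactly one node more than \<open>N l\<close>, so \<open>\<Lambda> l D = 0\<close> gives \<open>D = 0\<close> at that node\<close>
  have vanish: "l \<le> H + 1 \<longrightarrow> (\<forall>z\<in>nodes p \<alpha> (N l). D z = 0)" if "L \<le> l" for l
    using that
  proof (induction l rule: int_ge_induct)
    \<comment> \<open>At the nodes of \<open>N L\<close> no functional is used: every
      \<open>\<phi> k\<close> vanishes there because \<open>N\<close> increases, and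
      \<open>W\<close> does so by \<open>low\<close>.\<close>
    case base
    have "D z = 0" if z: "z \<in> nodes p \<alpha> (N L)" for z
    proof -
      have "\<phi> k z = 0" if k: "k \<in> {L..H}" for k
      proof -
        have "nodes p \<alpha> (N L) \<subseteq> nodes p \<alpha> (N k)" using k by (intro nodes_mono monoN) auto
        with z have "z \<in> nodes p \<alpha> (N k)" by blast
        then show ?thesis using zprod_eq_0_iff[OF nonint_alpha N0[of k]] k by (simp add: \<phi>_def)
      qed
      moreover have "W z = 0"
      proof -
        obtain i k where ik: "i \<in> {1..p}" "int k < N L i" "z = \<alpha> i + real k"
          using z unfolding nodes_def by blast
        then have "int k + 1 < N 0 i" using low[OF ik(1)] by simp
        then have "\<alpha> i + of_int (int k + 1) \<in> nodes p \<alpha> (N 0)"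
          using mem_nodes_iff[OF nonint_alpha ik(1), of "int k + 1" "N 0"] by simp
        then have "z + 1 \<in> nodes p \<alpha> (N 0)" using ik by (simp add: add.assoc)
        then show ?thesis using zprod_eq_0_iff[OF nonint_alpha N0[of 0]] LH by (simp add: W_def)
      qed
      ultimately show ?thesis by (simp add: D_def)
    qed
    then show ?case by blast
  next
    case (step l)
    show ?case
    proof
      assume "l + 1 \<le> H + 1"
      with step have l: "l \<in> {L..H}" and IH: "\<forall>z\<in>nodes p \<alpha> (N l). D z = 0" by auto
      obtain a b where ab: "step_at p a (N l) (N (l + 1))" "step_at q b (M (l - 1)) (M l)"
        using stepN[OF l] stepM[OF l] by blast
      have h: "multi_index p (N l)" "multi_index q (M l)" using l by (auto intro: N0 M0)
      note pd = pairing_dual[OF ab h sepl[OF l] sums[OF l]]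
      define z where "z = \<alpha> a + of_int (N l a)"
      have Na: "0 \<le> N l a" using h ab by (auto simp: multi_index_def step_at_def)
      note ns = nodes_step[OF nonint_alpha ab(1) Na, folded z_def]
      have "\<Lambda> l D = (\<Sum>w\<in>{z}. cA (N (l + 1)) (M (l - 1)) w * D w)"
        unfolding \<Lambda>_def using IH ns by (intro sum.mono_neutral_right) auto
      with \<Lambda>D[OF l] have "cA (N (l + 1)) (M (l - 1)) z * D z = 0" by simp
      moreover have "cA (N (l + 1)) (M (l - 1)) z \<noteq> 0"
        using pd(5) by (auto simp: form_coeff_def node_weight_def z_def)
      ultimately show "\<forall>z\<in>nodes p \<alpha> (N (l + 1)). D z = 0" using IH ns by auto
    qed
  qed

  define T where "T = nodes q \<beta> (M H)"
  \<comment> \<open>The coefficient of the power with exponent \<open>y\<close> in the difference of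
    both sides of the recurrence.\<close>
  define d where "d = (\<lambda>y. (if y - 1 \<in> nodes q \<beta> (M 0) then cB (N 0) (M 0) (y - 1) else 0)
      - (\<Sum>l\<in>{L..H}. r l * (if y \<in> nodes q \<beta> (M l) then cB (N l) (M l) y else 0)))"
  \<comment> \<open>The test function is arbitrary: \<open>1 / (y + z + 1)\<close> yields
    \<open>D z\<close>, and \<open>exp (y * ln x)\<close> yields the difference itself.\<close>
  have key: "(\<Sum>y\<in>T. d y * g y) = (\<Sum>y\<in>nodes q \<beta> (M 0). cB (N 0) (M 0) y * g (y + 1))
      - (\<Sum>l\<in>{L..H}. r l * (\<Sum>y\<in>nodes q \<beta> (M l). cB (N l) (M l) y * g y))" for g
  proof -
    have T: "finite T" by (simp add: T_def)
    have shift: "y + 1 \<in> T" if y: "y \<in> nodes q \<beta> (M 0)" for y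
    proof -
      obtain j k where jk: "j \<in> {1..q}" "int k < M 0 j" "y = \<beta> j + real k"
        using y unfolding nodes_def by blast
      then have "\<beta> j + of_int (int k + 1) \<in> T"
        unfolding T_def using mem_nodes_iff[OF nonint_beta jk(1), of "int k + 1" "M H"] high[OF jk(1)] by simp
      then show ?thesis using jk by (simp add: add.assoc)
    qed
    have sub: "nodes q \<beta> (M l) \<subseteq> T" if "l \<in> {L..H}" for l
      unfolding T_def using that by (intro nodes_mono monoM) auto
    have "(\<Sum>y\<in>T. d y * g y) =
       (\<Sum>y\<in>T. (if y - 1 \<in> nodes q \<beta> (M 0) then cB (N 0) (M 0) (y - 1) else 0) * g y) -
       (\<Sum>y\<in>T. \<Sum>l\<in>{L..H}. r l * ((if y \<in> nodes q \<beta> (M l) then cB (N l) (M l) y else 0) * g y))"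
      unfolding d_def by (simp only: left_diff_distrib sum_subtractf sum_distrib_right mult.assoc)
    also have "(\<Sum>y\<in>T. \<Sum>l\<in>{L..H}. r l * ((if y \<in> nodes q \<beta> (M l) then cB (N l) (M l) y else 0) * g y)) =
       (\<Sum>l\<in>{L..H}. r l * (\<Sum>y\<in>T. (if y \<in> nodes q \<beta> (M l) then cB (N l) (M l) y else 0) * g y))"
      by (subst sum.swap) (simp only: sum_distrib_left)
    also have "\<dots> = (\<Sum>l\<in>{L..H}. r l * (\<Sum>y\<in>nodes q \<beta> (M l). cB (N l) (M l) y * g y))"
      using sum_extend_zero[OF T sub] by (intro sum.cong refl) simp
    also have "(\<Sum>y\<in>T. (if y - 1 \<in> nodes q \<beta> (M 0) then cB (N 0) (M 0) (y - 1) else 0) * g y) =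
       (\<Sum>y\<in>nodes q \<beta> (M 0). cB (N 0) (M 0) y * g (y + 1))"
      by (rule sum_extend_zero_shift[OF T shift])
    finally show ?thesis .
  qed
  have d0: "d y = 0" if "y \<in> T" for y
  proof (rule cauchy_system_trivial[OF _ _ that])
    show "finite T" by (simp add: T_def)
    \<comment> \<open>The total of \<open>M H\<close> exceeds that of \<open>N H\<close> by one, and
      so does the total of \<open>N (H + 1)\<close>: the Cauchy system is square.\<close>
    have "int (card T) = int (card (nodes p \<alpha> (N (H + 1))))"
      unfolding T_def using LH sums[of H] sumN[of H]
      by (subst card_nodes_int[OF nonint_beta M0] card_nodes_int[OF nonint_alpha N0]; simp)+
    then show "card T \<le> card (nodes p \<alpha> (N (H + 1)))" by simp
  next
    fix z y assume "z \<in> nodes p \<alpha> (N (H + 1))" "y \<in> T"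
    then show "y + z + 1 \<noteq> 0" using node_node unfolding T_def by fastforce
  next
    fix z assume z: "z \<in> nodes p \<alpha> (N (H + 1))"
    have "(\<Sum>y\<in>T. d y / (y + z + 1)) = (\<Sum>y\<in>T. d y * (1 / (y + z + 1)))" by simp
    also have "\<dots> = (\<Sum>y\<in>nodes q \<beta> (M 0). cB (N 0) (M 0) y / (y + (z + 1) + 1))
      - (\<Sum>l\<in>{L..H}. r l * (\<Sum>y\<in>nodes q \<beta> (M l). cB (N l) (M l) y / (y + (z + 0) + 1)))"
      unfolding key by (simp add: algebra_simps)
    also have "\<dots> = D z"
    proof -
      have "(\<Sum>y\<in>nodes q \<beta> (M 0). cB (N 0) (M 0) y / (y + (z + 1) + 1)) = W z"
        unfolding W_def using LH by (intro mellin_B[OF N0 M0 sums z]) auto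
      moreover have "(\<Sum>y\<in>nodes q \<beta> (M l). cB (N l) (M l) y / (y + (z + 0) + 1)) = \<phi> l z" if "l \<in> {L..H}" for l
      proof -
        have "(\<Sum>y\<in>nodes q \<beta> (M l). cB (N l) (M l) y / (y + (z + 0) + 1)) =
            zprod p \<alpha> (N l) (z + 0) / pprod q \<beta> (M l) (z + 0)"
          using that by (intro mellin_B[OF N0 M0 sums z]) auto
        then show ?thesis by (simp add: \<phi>_def)
      qed
      ultimately show ?thesis unfolding D_def by simp
    qed
    also have "\<dots> = 0" using vanish[of "H + 1"] z LH by auto
    finally show "(\<Sum>y\<in>T. d y / (y + z + 1)) = 0" .
  qed
  have "(\<Sum>y\<in>T. d y * exp (y * ln x)) = 0" using d0 by simp
  then have "(\<Sum>y\<in>nodes q \<beta> (M 0). cB (N 0) (M 0) y * exp ((y + 1) * ln x)) =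
      (\<Sum>l\<in>{L..H}. r l * (\<Sum>y\<in>nodes q \<beta> (M l). cB (N l) (M l) y * exp (y * ln x)))"
    unfolding key by simp
  moreover have "(\<Sum>y\<in>nodes q \<beta> (M 0). cB (N 0) (M 0) y * exp ((y + 1) * ln x)) =
      x * power_sum (nodes q \<beta> (M 0)) (cB (N 0) (M 0)) x"
    unfolding power_sum_def sum_distrib_left
    by (intro sum.cong refl) (simp add: ring_distribs exp_add x)
  ultimately have "x * power_sum (nodes q \<beta> (M 0)) (cB (N 0) (M 0)) x =
      (\<Sum>l\<in>{L..H}. r l * power_sum (nodes q \<beta> (M l)) (cB (N l) (M l)) x)"
    by (simp add: power_sum_def)
  then have "of_real (x * power_sum (nodes q \<beta> (M 0)) (cB (N 0) (M 0)) x) =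
      (of_real (\<Sum>l\<in>{L..H}. r l * power_sum (nodes q \<beta> (M l)) (cB (N l) (M l)) x) :: complex)"
    by simp
  moreover have "B (N l) (M l) x = of_real (power_sum (nodes q \<beta> (M l)) (cB (N l) (M l)) x)" if "l \<in> {L..H}" for l
    using that B_eq[OF N0[of l] M0[of l]] by simp
  ultimately show ?thesis using LH cr by simp
qed

end

section \<open>The recurrence coefficients\<close>

context pineiro_system
begin

text \<open>Made for the backward coefficients, where \<open>u\<close> arises from \<open>n\<close>
  by lowering rows. A lowered row contributes nothing, since \<open>z + 1\<close> is still a node of
  \<open>n\<close> for each of its nodes \<open>z\<close>.\<close>

lemma xpairing_alpha_sum:
  assumes n: "multi_index p n" and m: "multi_index q m"
    and sum_m: "(\<Sum>j = 1..q. m j) = (\<Sum>i = 1..p. n i) + 1"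
    and u: "multi_index p u" and sep: "sepA u v"
    and nu: "\<And>i. i \<in> {1..p} \<Longrightarrow> n i = u i \<or> n i = u i + 1"
    and K: "K = {k \<in> {1..p}. n k = u k}"
  shows "xpairing (A u v) (B n m) = of_real (\<Sum>k\<in>K.
     pprod q \<beta> v (\<alpha> k + of_int (n k) - 1) / pprod q \<beta> m (\<alpha> k + of_int (n k)) *
     ((\<Prod>i = 1..p. \<alpha> i - \<alpha> k - of_int (n k)) / (\<Prod>i\<in>K - {k}. \<alpha> i - \<alpha> k - of_int (n k) + of_int (n i))))"
proof -
  have "(\<Sum>z\<in>nodes p \<alpha> u. cA u v z * (zprod p \<alpha> n (z + 1) / pprod q \<beta> m (z + 1))) =
    (\<Sum>z\<in>nodes p \<alpha> u. node_weight p \<alpha> u z * (pprod q \<beta> v z / pprod q \<beta> m (z + 1)) * zprod p \<alpha> n (z + 1))"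
    by (simp add: form_coeff_def field_simps)
  also have "\<dots> = (\<Sum>k\<in>K. pprod q \<beta> v (\<alpha> k + of_int (u k) - 1) / pprod q \<beta> m (\<alpha> k + of_int (u k) - 1 + 1) *
       ((\<Prod>i = 1..p. \<alpha> i - \<alpha> k - of_int (u k)) / (\<Prod>i\<in>K - {k}. \<alpha> i - \<alpha> k - of_int (u k) + of_int (u i))))"
    by (rule shifted_node_sum[OF nonint_alpha u nu K])
  also have "\<dots> = (\<Sum>k\<in>K. pprod q \<beta> v (\<alpha> k + of_int (n k) - 1) / pprod q \<beta> m (\<alpha> k + of_int (n k)) *
       ((\<Prod>i = 1..p. \<alpha> i - \<alpha> k - of_int (n k)) / (\<Prod>i\<in>K - {k}. \<alpha> i - \<alpha> k - of_int (n k) + of_int (n i))))"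
  proof (rule sum.cong[OF refl])
    fix k assume "k \<in> K"
    then have k: "u k = n k" by (simp add: K)
    have "(\<Prod>i\<in>K - {k}. \<alpha> i - \<alpha> k - of_int (n k) + of_int (u i)) =
          (\<Prod>i\<in>K - {k}. \<alpha> i - \<alpha> k - of_int (n k) + of_int (n i))"
      by (rule prod.cong) (auto simp: K)
    then show "pprod q \<beta> v (\<alpha> k + of_int (u k) - 1) / pprod q \<beta> m (\<alpha> k + of_int (u k) - 1 + 1) *
       ((\<Prod>i = 1..p. \<alpha> i - \<alpha> k - of_int (u k)) / (\<Prod>i\<in>K - {k}. \<alpha> i - \<alpha> k - of_int (u k) + of_int (u i))) =
       pprod q \<beta> v (\<alpha> k + of_int (n k) - 1) / pprod q \<beta> m (\<alpha> k + of_int (n k)) *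
       ((\<Prod>i = 1..p. \<alpha> i - \<alpha> k - of_int (n k)) / (\<Prod>i\<in>K - {k}. \<alpha> i - \<alpha> k - of_int (n k) + of_int (n i)))"
      unfolding k by simp
  qed
  finally show ?thesis unfolding xpairing_A_B[OF n m sum_m u sep] by simp
qed

text \<open>The mirror image for the forward coefficients, over the poles of \<open>B\<close>:
  \<open>v\<close> arises from \<open>m\<close> by raising rows, and only the rows not raised
  survive.\<close>

lemma xpairing_beta_sum:
  assumes n: "multi_index p n" and m: "multi_index q m"
    and sum_m: "(\<Sum>j = 1..q. m j) = (\<Sum>i = 1..p. n i) + 1"
    and u: "multi_index p u" and v: "multi_index q v"
    and sum_u: "(\<Sum>i = 1..p. u i) = (\<Sum>j = 1..q. v j) + 1"
    and vm: "\<And>j. j \<in> {1..q} \<Longrightarrow> v j = m j \<or> v j = m j + 1"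
    and K: "K = {k \<in> {1..q}. v k = m k}"
  shows "xpairing (A u v) (B n m) = of_real (\<Sum>k\<in>K.
     pprod p \<alpha> n (\<beta> k + of_int (m k) - 1) / pprod p \<alpha> u (\<beta> k + of_int (m k)) *
     ((\<Prod>h = 1..q. \<beta> h - \<beta> k - of_int (m k)) / (\<Prod>h\<in>K - {k}. \<beta> h - \<beta> k - of_int (m k) + of_int (m h))))"
proof -
  have "(\<Sum>y\<in>nodes q \<beta> m. cB n m y * (zprod q \<beta> v (y + 1) / pprod p \<alpha> u (y + 1))) =
    (\<Sum>y\<in>nodes q \<beta> m. node_weight q \<beta> m y * (pprod p \<alpha> n y / pprod p \<alpha> u (y + 1)) * zprod q \<beta> v (y + 1))"
    by (simp add: form_coeff_def field_simps)
  also have "\<dots> = (\<Sum>k\<in>K. pprod p \<alpha> n (\<beta> k + of_int (m k) - 1) / pprod p \<alpha> u (\<beta> k + of_int (m k) - 1 + 1) *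
       ((\<Prod>h = 1..q. \<beta> h - \<beta> k - of_int (m k)) / (\<Prod>h\<in>K - {k}. \<beta> h - \<beta> k - of_int (m k) + of_int (m h))))"
    by (rule shifted_node_sum[OF nonint_beta m vm K])
  finally show ?thesis
    unfolding xpairing_A_B'[OF n m sum_m u sepA_nonneg[OF v] v sum_u] by simp
qed

lemma pprod_shift_ratio:
  assumes "multi_index q m" "\<And>h. h \<in> {1..q} \<Longrightarrow> z + \<beta> h + 1 > 0"
  shows "pprod q \<beta> m z / pprod q \<beta> m (z + 1) = (\<Prod>h = 1..q. (z + \<beta> h + 1) / (z + \<beta> h + of_int (m h) + 1))"
  unfolding pprod_def prod_dividef[symmetric]
proof (rule prod.cong[OF refl])
  fix h assume h: "h \<in> {1..q}"
  have m: "0 \<le> m h" using assms(1) h by (simp add: multi_index_def)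
  have "ipoch (z + 1 + \<beta> h + 1) (m h) \<noteq> 0"
    using ipoch_pos[OF _ m, of "z + 1 + \<beta> h + 1"] assms(2)[OF h] by auto
  from ipoch_shift_ratio[OF m _ this] assms(2)[OF h] m
  show "ipoch (z + \<beta> h + 1) (m h) / ipoch (z + 1 + \<beta> h + 1) (m h) = (z + \<beta> h + 1) / (z + \<beta> h + of_int (m h) + 1)"
    by (simp add: algebra_simps)
qed

lemma zprod_shift_ratio:
  assumes n: "multi_index p n" and a: "a \<in> {1..p}"
  defines "z \<equiv> \<alpha> a + of_int (n a)"
  shows "zprod p \<alpha> n (z + 1) / zprod p \<alpha> n z = (\<Prod>i = 1..p. (\<alpha> i - z - 1) / (\<alpha> i - z + of_int (n i) - 1))"
  unfolding zprod_def prod_dividef[symmetric]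
proof (rule prod.cong[OF refl])
  fix i assume i: "i \<in> {1..p}"
  have ni: "0 \<le> n i" using n i by (simp add: multi_index_def)
  have "z \<notin> nodes p \<alpha> n" unfolding z_def using mem_nodes_iff[OF nonint_alpha a] by simp
  then have "zprod p \<alpha> n z \<noteq> 0" using zprod_eq_0_iff[OF nonint_alpha n] by simp
  then have "ipoch (\<alpha> i - z) (n i) \<noteq> 0" using i by (simp add: zprod_def)
  \<comment> \<open>Vanishing would force \<open>i = a\<close> and then
    \<open>n a = n a + 1\<close>.\<close>
  moreover have "\<alpha> i - z + of_int (n i) - 1 \<noteq> 0"
    using nonint_diffs_eqD[OF nonint_alpha i a, of "n i" "n a + 1"] by (auto simp: z_def)
  ultimately show "ipoch (\<alpha> i - (z + 1)) (n i) / ipoch (\<alpha> i - z) (n i) = (\<alpha> i - z - 1) / (\<alpha> i - z + of_int (n i) - 1)"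
    using ipoch_shift_ratio[OF ni, of "\<alpha> i - z"] by (simp add: diff_diff_eq)
qed

text \<open>Now \<open>u\<close> has one node \<open>z = \<alpha> a + n a\<close> beyond those of
  \<open>n\<close>. Its term is split off and yields the first two products. On the nodes of
  \<open>n\<close> the extra factor \<open>1 / (z - w)\<close> joins the free function of
  \<open>shifted_node_sum\<close>, applied with no row extended, so that all rows enter the
  sum.\<close>

lemma diagonal_coeff:
  assumes n: "multi_index p n" and m: "multi_index q m"
    and sum_m: "(\<Sum>j = 1..q. m j) = (\<Sum>i = 1..p. n i) + 1"
    and st: "step_at p a n u" "step_at q b v m" and sep: "sepA u v"
  shows "pairing (A u v) (B n m) \<noteq> 0"
    and "xpairing (A u v) (B n m) / pairing (A u v) (B n m) = of_real (
      (\<Prod>h = 1..q. (\<alpha> a + \<beta> h + of_int (n a) + 1) / (\<alpha> a + \<beta> h + of_int (n a) + of_int (m h) + 1))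
      * (\<Prod>i = 1..p. (\<alpha> i - \<alpha> a - of_int (n a) - 1) / (\<alpha> i - \<alpha> a - of_int (n a) + of_int (n i) - 1))
      + (\<Sum>k = 1..p. (\<alpha> a + \<beta> b + of_int (n a) + of_int (m b))
          / ((\<alpha> k + \<beta> b + of_int (n k) + of_int (m b) - 1) * (\<alpha> a - \<alpha> k - of_int (n k) + of_int (n a) + 1))
        * (\<Prod>h = 1..q. (\<alpha> k + \<beta> h + of_int (n k)) / (\<alpha> k + \<beta> h + of_int (n k) + of_int (m h)))
        * ((\<Prod>i = 1..p. \<alpha> i - \<alpha> k - of_int (n k))
            / (\<Prod>i\<in>{1..p} - {k}. \<alpha> i - \<alpha> k - of_int (n k) + of_int (n i)))))"
proof -
  define z where "z = \<alpha> a + of_int (n a)"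
  \<comment> \<open>The reciprocal of the pairing, by which the integral with \<open>x\<close> is to
    be multiplied.\<close>
  define C where "C = z + \<beta> b + of_int (m b)"
  have a: "a \<in> {1..p}" and vb: "v b = m b - 1" using st by (auto simp: step_at_def)
  have na: "0 \<le> n a" using n a by (simp add: multi_index_def)
  have u: "multi_index p u" using step_at_le[OF st(1)] n by (force simp: multi_index_def)
  note pd = pairing_dual[OF st n m sep sum_m, folded z_def]
  have C0: "C \<noteq> 0" using pd(4) by (simp add: C_def vb)
  have pair: "pairing (A u v) (B n m) = of_real (1 / C)" unfolding pd(1) pd(3) C_def vb by simp
  then show "pairing (A u v) (B n m) \<noteq> 0" using C0 by simp
  have pv: "pprod q \<beta> v w = pprod q \<beta> m w / (w + \<beta> b + of_int (m b))" "w + \<beta> b + of_int (m b) \<noteq> 0"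
    if "w \<in> nodes p \<alpha> u" for w
    using separated_node[OF st(2) m sep that] by (simp_all add: vb field_simps)
  define F where "F = (\<lambda>w. pprod q \<beta> v w / pprod q \<beta> m (w + 1))"
  have F: "F w = (\<Prod>h = 1..q. (w + \<beta> h + 1) / (w + \<beta> h + of_int (m h) + 1)) / (w + \<beta> b + of_int (m b))"
    if "w \<in> nodes p \<alpha> u" for w
  proof -
    have "F w = pprod q \<beta> m w / pprod q \<beta> m (w + 1) / (w + \<beta> b + of_int (m b))"
      unfolding F_def pv(1)[OF that] by (simp add: mult.commute)
    also have "pprod q \<beta> m w / pprod q \<beta> m (w + 1) =
        (\<Prod>h = 1..q. (w + \<beta> h + 1) / (w + \<beta> h + of_int (m h) + 1))"
      by (rule pprod_shift_ratio[OF m node_beta[OF that]])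
    finally show ?thesis .
  qed
  note ns = nodes_step[OF nonint_alpha st(1) na, folded z_def]
  have "(\<Sum>w\<in>nodes p \<alpha> u. cA u v w * (zprod p \<alpha> n (w + 1) / pprod q \<beta> m (w + 1))) =
      (\<Sum>w\<in>nodes p \<alpha> u. node_weight p \<alpha> u w * F w * zprod p \<alpha> n (w + 1))"
    by (simp add: form_coeff_def F_def field_simps)
  also have "\<dots> = node_weight p \<alpha> u z * F z * zprod p \<alpha> n (z + 1) +
      (\<Sum>w\<in>nodes p \<alpha> n. node_weight p \<alpha> u w * F w * zprod p \<alpha> n (w + 1))"
    using ns by simp
  also have "node_weight p \<alpha> u z * F z * zprod p \<alpha> n (z + 1) = F z * (zprod p \<alpha> n (z + 1) / zprod p \<alpha> n z)"
    using node_weight_step_new[OF nonint_alpha n st(1)] by (simp add: field_simps flip: z_def)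
  also have "(\<Sum>w\<in>nodes p \<alpha> n. node_weight p \<alpha> u w * F w * zprod p \<alpha> n (w + 1)) =
     (\<Sum>w\<in>nodes p \<alpha> n. node_weight p \<alpha> n w * (F w / (z - w)) * zprod p \<alpha> n (w + 1))"
    using node_weight_step_old[OF nonint_alpha st(1) na] by (intro sum.cong refl) (simp flip: z_def)
  also have "\<dots> = (\<Sum>k = 1..p. F (\<alpha> k + of_int (n k) - 1) / (z - (\<alpha> k + of_int (n k) - 1)) *
       ((\<Prod>i = 1..p. \<alpha> i - \<alpha> k - of_int (n k)) / (\<Prod>i\<in>{1..p} - {k}. \<alpha> i - \<alpha> k - of_int (n k) + of_int (n i))))"
    by (rule shifted_node_sum[OF nonint_alpha n]) auto
  finally have xp: "xpairing (A u v) (B n m) = of_real (F z * (zprod p \<alpha> n (z + 1) / zprod p \<alpha> n z) +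
     (\<Sum>k = 1..p. F (\<alpha> k + of_int (n k) - 1) / (z - (\<alpha> k + of_int (n k) - 1)) *
       ((\<Prod>i = 1..p. \<alpha> i - \<alpha> k - of_int (n k)) / (\<Prod>i\<in>{1..p} - {k}. \<alpha> i - \<alpha> k - of_int (n k) + of_int (n i)))))"
    unfolding xpairing_A_B[OF n m sum_m u sep] by simp
  have first: "C * (F z * (zprod p \<alpha> n (z + 1) / zprod p \<alpha> n z)) =
      (\<Prod>h = 1..q. (\<alpha> a + \<beta> h + of_int (n a) + 1) / (\<alpha> a + \<beta> h + of_int (n a) + of_int (m h) + 1))
      * (\<Prod>i = 1..p. (\<alpha> i - \<alpha> a - of_int (n a) - 1) / (\<alpha> i - \<alpha> a - of_int (n a) + of_int (n i) - 1))"
  proof -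
    have "C * F z = (\<Prod>h = 1..q. (z + \<beta> h + 1) / (z + \<beta> h + of_int (m h) + 1))"
      using F[OF pd(2)] C0 by (simp add: C_def)
    moreover have "zprod p \<alpha> n (z + 1) / zprod p \<alpha> n z = (\<Prod>i = 1..p. (\<alpha> i - z - 1) / (\<alpha> i - z + of_int (n i) - 1))"
      unfolding z_def by (rule zprod_shift_ratio[OF n a])
    ultimately show ?thesis unfolding mult.assoc[symmetric] by (simp add: z_def algebra_simps)
  qed
  have rest: "C * (F (\<alpha> k + of_int (n k) - 1) / (z - (\<alpha> k + of_int (n k) - 1)) *
       ((\<Prod>i = 1..p. \<alpha> i - \<alpha> k - of_int (n k)) / (\<Prod>i\<in>{1..p} - {k}. \<alpha> i - \<alpha> k - of_int (n k) + of_int (n i)))) =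
      (\<alpha> a + \<beta> b + of_int (n a) + of_int (m b))
          / ((\<alpha> k + \<beta> b + of_int (n k) + of_int (m b) - 1) * (\<alpha> a - \<alpha> k - of_int (n k) + of_int (n a) + 1))
        * (\<Prod>h = 1..q. (\<alpha> k + \<beta> h + of_int (n k)) / (\<alpha> k + \<beta> h + of_int (n k) + of_int (m h)))
        * ((\<Prod>i = 1..p. \<alpha> i - \<alpha> k - of_int (n k))
            / (\<Prod>i\<in>{1..p} - {k}. \<alpha> i - \<alpha> k - of_int (n k) + of_int (n i)))"
    (is "C * (_ / _ * ?R) = _ / (?c1 * ?c2) * ?P * ?R")
    if k: "k \<in> {1..p}" for k
  proof (cases "n k = 0")
    \<comment> \<open>\<open>F\<close> is known at nodes only, and \<open>\<alpha> k - 1\<close> is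
      none. But the factor \<open>i = k\<close> of the product is 0, so both sides vanish.\<close>
    case True
    then have "(\<Prod>i = 1..p. \<alpha> i - \<alpha> k - of_int (n k)) = 0" using k by auto
    then show ?thesis by (simp only: div_0 mult_zero_right)
  next
    case False
    moreover have "0 \<le> n k" using n k by (simp add: multi_index_def)
    ultimately have "1 \<le> n k" by simp
    then have "\<alpha> k + of_int (n k - 1) \<in> nodes p \<alpha> n" using mem_nodes_iff[OF nonint_alpha k, of "n k - 1" n] by simp
    then have w: "\<alpha> k + of_int (n k) - 1 \<in> nodes p \<alpha> u" using ns by (simp add: algebra_simps)
    have Fw: "F (\<alpha> k + of_int (n k) - 1) = ?P / ?c1"
      unfolding F[OF w] by (simp add: algebra_simps)
    have c2: "z - (\<alpha> k + of_int (n k) - 1) = ?c2" by (simp add: z_def)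
    have C': "C = \<alpha> a + \<beta> b + of_int (n a) + of_int (m b)" by (simp add: C_def z_def)
    show ?thesis unfolding Fw c2 C' by simp
  qed
  have "xpairing (A u v) (B n m) / pairing (A u v) (B n m) = of_real (C *
    (F z * (zprod p \<alpha> n (z + 1) / zprod p \<alpha> n z) +
     (\<Sum>k = 1..p. F (\<alpha> k + of_int (n k) - 1) / (z - (\<alpha> k + of_int (n k) - 1)) *
       ((\<Prod>i = 1..p. \<alpha> i - \<alpha> k - of_int (n k)) / (\<Prod>i\<in>{1..p} - {k}. \<alpha> i - \<alpha> k - of_int (n k) + of_int (n i))))))"
    unfolding pair xp by (simp only: of_real_divide[symmetric]) (simp add: mult.commute)
  also have "\<dots> = of_real (C * (F z * (zprod p \<alpha> n (z + 1) / zprod p \<alpha> n z)) +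
     (\<Sum>k = 1..p. C * (F (\<alpha> k + of_int (n k) - 1) / (z - (\<alpha> k + of_int (n k) - 1)) *
       ((\<Prod>i = 1..p. \<alpha> i - \<alpha> k - of_int (n k)) / (\<Prod>i\<in>{1..p} - {k}. \<alpha> i - \<alpha> k - of_int (n k) + of_int (n i))))))"
    unfolding distrib_left sum_distrib_left ..
  also have "(\<Sum>k = 1..p. C * (F (\<alpha> k + of_int (n k) - 1) / (z - (\<alpha> k + of_int (n k) - 1)) *
       ((\<Prod>i = 1..p. \<alpha> i - \<alpha> k - of_int (n k)) / (\<Prod>i\<in>{1..p} - {k}. \<alpha> i - \<alpha> k - of_int (n k) + of_int (n i))))) =
     (\<Sum>k = 1..p. (\<alpha> a + \<beta> b + of_int (n a) + of_int (m b))
          / ((\<alpha> k + \<beta> b + of_int (n k) + of_int (m b) - 1) * (\<alpha> a - \<alpha> k - of_int (n k) + of_int (n a) + 1))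
        * (\<Prod>h = 1..q. (\<alpha> k + \<beta> h + of_int (n k)) / (\<alpha> k + \<beta> h + of_int (n k) + of_int (m h)))
        * ((\<Prod>i = 1..p. \<alpha> i - \<alpha> k - of_int (n k))
            / (\<Prod>i\<in>{1..p} - {k}. \<alpha> i - \<alpha> k - of_int (n k) + of_int (n i))))"
    by (rule sum.cong[OF refl rest])
  finally show "xpairing (A u v) (B n m) / pairing (A u v) (B n m) = of_real (
      (\<Prod>h = 1..q. (\<alpha> a + \<beta> h + of_int (n a) + 1) / (\<alpha> a + \<beta> h + of_int (n a) + of_int (m h) + 1))
      * (\<Prod>i = 1..p. (\<alpha> i - \<alpha> a - of_int (n a) - 1) / (\<alpha> i - \<alpha> a - of_int (n a) + of_int (n i) - 1))
      + (\<Sum>k = 1..p. (\<alpha> a + \<beta> b + of_int (n a) + of_int (m b))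
          / ((\<alpha> k + \<beta> b + of_int (n k) + of_int (m b) - 1) * (\<alpha> a - \<alpha> k - of_int (n k) + of_int (n a) + 1))
        * (\<Prod>h = 1..q. (\<alpha> k + \<beta> h + of_int (n k)) / (\<alpha> k + \<beta> h + of_int (n k) + of_int (m h)))
        * ((\<Prod>i = 1..p. \<alpha> i - \<alpha> k - of_int (n k))
            / (\<Prod>i\<in>{1..p} - {k}. \<alpha> i - \<alpha> k - of_int (n k) + of_int (n i)))))"
    unfolding first .
qed

end

section \<open>Index paths and the theorem\<close>

lemma index_path_0: "index_path d \<pi> 0 = 0"
  by (simp add: index_path_def fun_eq_iff)

lemma index_path_nonneg: "0 \<le> index_path d \<pi> l a"
  by (simp add: index_path_def sum_nonneg)

lemma index_path_permuted:
  assumes "\<pi> permutes {1..d}" "k \<in> {1..d}" "l \<le> d"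
  shows "index_path d \<pi> l (\<pi> k) = (if k \<le> l then 1 else 0)"
proof (cases "l = d")
  case True
  then show ?thesis using assms(2) by (simp add: index_path_def)
next
  case False
  with assms have l: "l < d" by simp
  have "(\<pi> i = \<pi> k) = (i = k)" for i using permutes_inj[OF assms(1)] by (auto simp: inj_def)
  then have "index_path d \<pi> l (\<pi> k) = (\<Sum>i = 1..l. if i = k then 1 else 0)"
    using l by (simp add: index_path_def)
  also have "\<dots> = (if k \<le> l then 1 else 0)" using assms(2) by simp
  finally show ?thesis .
qed

lemma index_path_step:
  assumes "\<pi> permutes {1..d}" "1 \<le> d"
  shows "step_at d (\<pi> (l mod d + 1)) (index_path d \<pi> l) (index_path d \<pi> (l + 1))"
proof -
  have "l mod d < d" using assms(2) by simp
  then have mem: "l mod d + 1 \<in> {1..d}" by auto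
  then have \<pi>mem: "\<pi> (l mod d + 1) \<in> {1..d}" using permutes_in_image[OF assms(1)] by blast
  have "index_path d \<pi> (l + 1) a = index_path d \<pi> l a + (if \<pi> (l mod d + 1) = a then 1 else 0)"
    if a: "a \<in> {1..d}" for a
  proof (cases "l mod d + 1 = d")
    case False
    then have "(l + 1) mod d = l mod d + 1" "(l + 1) div d = l div d"
      using mem by (auto simp: mod_Suc div_Suc)
    then show ?thesis by (simp add: index_path_def)
  next
    \<comment> \<open>The last step of a round: the partial sum restarts at 0 and the number of full
      rounds rises. Only the component visited last changes, as the others were raised earlier in
      the round.\<close>
    case True
    then have *: "(l + 1) mod d = 0" "(l + 1) div d = l div d + 1"
      by (auto simp: mod_Suc div_Suc)
    obtain k where k: "k \<in> {1..d}" "a = \<pi> k"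
      using permutes_image[OF assms(1)] a by (metis imageE)
    have eq: "(\<pi> i = a) = (i = k)" for i using permutes_inj[OF assms(1)] k by (auto simp: inj_def)
    have "(\<Sum>i = 1..l mod d. if i = k then 1 else 0) + (if l mod d + 1 = k then 1 else 0) = (1 :: int)"
      using k(1) True by auto
    then show ?thesis unfolding index_path_def eq using * by simp
  qed
  then show ?thesis using \<pi>mem unfolding step_at_def by auto
qed

lemma sum_index_path:
  assumes "\<pi> permutes {1..d}" "1 \<le> d"
  shows "(\<Sum>a = 1..d. index_path d \<pi> l a) = int l"
proof (induction l)
  case (Suc l)
  then show ?case using step_at_sum[OF index_path_step[OF assms, of l]] by simp
qed (simp add: index_path_0)

lemma index_path_mono:
  assumes "\<pi> permutes {1..d}" "1 \<le> d" "l \<le> l'" "a \<in> {1..d}"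
  shows "index_path d \<pi> l a \<le> index_path d \<pi> l' a"
  using assms(3)
proof (induction l' rule: dec_induct)
  case (step k)
  from step_at_le[OF index_path_step[OF assms(1,2)] assms(4), of k] step show ?case by simp
qed simp

lemma step_at_add: "step_at d k w w' \<Longrightarrow> step_at d k (u + w) (u + w')"
  by (auto simp: step_at_def)

lemma step_at_diff: "step_at d k w w' \<Longrightarrow> step_at d k (u - w') (u - w)"
  by (auto simp: step_at_def)

lemma prod_image_remove:
  assumes "inj \<pi>"
  shows "(\<Prod>i\<in>\<pi> ` J - {\<pi> k}. f i) = (\<Prod>i\<in>J - {k}. f (\<pi> i))"
proof -
  have "\<pi> ` J - {\<pi> k} = \<pi> ` (J - {k})" using assms by (auto simp: inj_def)
  then show ?thesis using assms by (simp add: prod.reindex inj_on_subset[OF assms])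
qed

text \<open>The origin of the lower limits \<open>j\<close> and \<open>i\<close> of the sums in the
  coefficients: the rows not yet visited by the path are those that survive in the shifted node
  sums.\<close>

lemma permuted_slice:
  assumes "\<pi> permutes {1..d}" "j \<in> {1..d}"
  shows "{k \<in> {1..d}. index_path d \<pi> (j - 1) k = 0} = \<pi> ` {j..d}"
proof (intro equalityI subsetI)
  fix a assume a: "a \<in> {k \<in> {1..d}. index_path d \<pi> (j - 1) k = 0}"
  then obtain k where k: "k \<in> {1..d}" "a = \<pi> k"
    using permutes_image[OF assms(1)] by (metis (no_types, lifting) imageE mem_Collect_eq)
  have "j - 1 \<le> d" using assms(2) by auto
  from index_path_permuted[OF assms(1) k(1) this] a k(2) have "\<not> k \<le> j - 1" by auto
  then show "a \<in> \<pi> ` {j..d}" using k by auto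
next
  fix a assume "a \<in> \<pi> ` {j..d}"
  then obtain k where k: "k \<in> {1..d}" "j \<le> k" "a = \<pi> k" using assms(2) by auto
  then have "index_path d \<pi> (j - 1) a = 0"
    using index_path_permuted[OF assms(1) k(1), of "j - 1"] assms(2) by auto
  moreover have "a \<in> {1..d}" using k permutes_in_image[OF assms(1)] by blast
  ultimately show "a \<in> {k \<in> {1..d}. index_path d \<pi> (j - 1) k = 0}" by simp
qed

lemma index_path_0_or_1:
  assumes "\<pi> permutes {1..d}" "l \<le> d" "a \<in> {1..d}"
  shows "index_path d \<pi> l a = 0 \<or> index_path d \<pi> l a = 1"
proof -
  obtain k where "k \<in> {1..d}" "a = \<pi> k"
    using permutes_image[OF assms(1)] assms(3) by (metis imageE)
  then show ?thesis using index_path_permuted[OF assms(1) _ assms(2)] by simp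
qed

lemma multi_index_add_path: "multi_index d u \<Longrightarrow> multi_index d (u + index_path d \<pi> l)"
  using index_path_nonneg by (force simp: multi_index_def)

theorem theorem5p20:
  fixes p q :: nat
    and \<alpha> \<beta> :: "nat \<Rightarrow> real"
    and n m :: "nat \<Rightarrow> int"
    and \<pi>s \<pi>\<ss> \<pi>t \<pi>\<tt> :: "nat \<Rightarrow> nat"
    and s \<ss> t \<tt> :: "nat \<Rightarrow> nat \<Rightarrow> int"
    and A B :: "(nat \<Rightarrow> int) \<Rightarrow> (nat \<Rightarrow> int) \<Rightarrow> real \<Rightarrow> complex"
    and bp bm :: "nat \<Rightarrow> complex" and b0 :: complex
  assumes pq: "1 \<le> p" "1 \<le> q"
    and alpha: "\<And>i. i \<in> {1..p} \<Longrightarrow> \<alpha> i > - 1"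
    and beta: "\<And>j. j \<in> {1..q} \<Longrightarrow> \<beta> j > - 1"
    and alpha_beta: "\<And>i j. i \<in> {1..p} \<Longrightarrow> j \<in> {1..q} \<Longrightarrow> \<alpha> i + \<beta> j > - 1"
    and alpha_diff: "\<And>i h. i \<in> {1..p} \<Longrightarrow> h \<in> {1..p} \<Longrightarrow> i \<noteq> h \<Longrightarrow> \<alpha> i - \<alpha> h \<notin> \<int>"
    and beta_diff: "\<And>j h. j \<in> {1..q} \<Longrightarrow> h \<in> {1..q} \<Longrightarrow> j \<noteq> h \<Longrightarrow> \<beta> j - \<beta> h \<notin> \<int>"
    and nm: "multi_index p n" "multi_index q m" "(\<Sum>j = 1..q. m j) = (\<Sum>i = 1..p. n i) + 1"
    and perms: "\<pi>s permutes {1..p}" "\<pi>\<ss> permutes {1..p}" "\<pi>t permutes {1..q}" "\<pi>\<tt> permutes {1..q}"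
    and paths: "s = index_path p \<pi>s" "\<ss> = index_path p \<pi>\<ss>" "t = index_path q \<pi>t" "\<tt> = index_path q \<pi>\<tt>"
    and forms: "A = pineiro_A p q \<alpha> \<beta>" "B = pineiro_B p q \<alpha> \<beta>"
    and bp: "\<And>j. bp j = xpairing (A (n + \<ss> (j + 1)) (m + t (j - 1))) (B n m)
                        / pairing (A (n + \<ss> (j + 1)) (m + t (j - 1))) (B (n + \<ss> j) (m + t j))"
    and b0: "b0 = xpairing (A (n + \<ss> 1) (m - \<tt> 1)) (B n m)
                  / pairing (A (n + \<ss> 1) (m - \<tt> 1)) (B n m)"
    and bm: "\<And>i. bm i = xpairing (A (n - s (i - 1)) (m - \<tt> (i + 1))) (B n m)
                        / pairing (A (n - s (i - 1)) (m - \<tt> (i + 1))) (B (n - s i) (m - \<tt> i))"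
  shows
    "(separated_A p q \<alpha> \<beta> (n + \<ss> 1) (m - \<tt> 1) \<and>
      (\<forall>i\<in>{1..p}. if multi_index p (n - s i) \<and> multi_index q (m - \<tt> i)
                 then separated_A p q \<alpha> \<beta> (n - s (i - 1)) (m - \<tt> (i + 1))
                 else n (\<pi>s i) = 0)
      \<longrightarrow> (\<forall>x\<in>{0<..<1}. of_real x * B n m x =
            (\<Sum>j = 1..q. bp j * B (n + \<ss> j) (m + t j) x) + b0 * B n m x
            + (\<Sum>i \<in> {i \<in> {1..p}. multi_index p (n - s i) \<and> multi_index q (m - \<tt> i)}.
                 bm i * B (n - s i) (m - \<tt> i) x)))
   \<and> (\<forall>j\<in>{1..q}.
        pairing (A (n + \<ss> (j + 1)) (m + t (j - 1))) (B (n + \<ss> j) (m + t j)) \<noteq> 0 \<and>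
        bp j = of_real (
          (\<Prod>a = 1..p. ipoch (\<alpha> a + \<beta> (\<pi>t j) + of_int (m (\<pi>t j)) + 1) ((n + \<ss> (j + 1)) a)
                     / ipoch (\<alpha> a + \<beta> (\<pi>t j) + of_int (m (\<pi>t j)) + 1) ((n + \<ss> j) a))
          * (\<Sum>k = j..q.
              (\<Prod>a = 1..p. ipoch (\<alpha> a + \<beta> (\<pi>t k) + of_int (m (\<pi>t k))) (n a)
                         / ipoch (\<alpha> a + \<beta> (\<pi>t k) + of_int (m (\<pi>t k)) + 1) ((n + \<ss> (j + 1)) a))
              * ((\<Prod>h = 1..q. \<beta> (\<pi>t h) - \<beta> (\<pi>t k) - of_int (m (\<pi>t k)))
                 / (\<Prod>h \<in> {j..q} - {k}. \<beta> (\<pi>t h) - \<beta> (\<pi>t k) - of_int (m (\<pi>t k)) + of_int (m (\<pi>t h)))))))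
   \<and> (separated_A p q \<alpha> \<beta> (n + \<ss> 1) (m - \<tt> 1) \<longrightarrow>
        pairing (A (n + \<ss> 1) (m - \<tt> 1)) (B n m) \<noteq> 0 \<and>
        b0 = of_real (
          (\<Prod>h = 1..q. (\<alpha> (\<pi>\<ss> 1) + \<beta> h + of_int (n (\<pi>\<ss> 1)) + 1)
                     / (\<alpha> (\<pi>\<ss> 1) + \<beta> h + of_int (n (\<pi>\<ss> 1)) + of_int (m h) + 1))
          * (\<Prod>a = 1..p. (\<alpha> a - \<alpha> (\<pi>\<ss> 1) - of_int (n (\<pi>\<ss> 1)) - 1)
                       / (\<alpha> a - \<alpha> (\<pi>\<ss> 1) - of_int (n (\<pi>\<ss> 1)) + of_int (n a) - 1))
          + (\<Sum>k = 1..p.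
              (\<alpha> (\<pi>\<ss> 1) + \<beta> (\<pi>\<tt> 1) + of_int (n (\<pi>\<ss> 1)) + of_int (m (\<pi>\<tt> 1)))
                / ((\<alpha> (\<pi>\<ss> k) + \<beta> (\<pi>\<tt> 1) + of_int (n (\<pi>\<ss> k)) + of_int (m (\<pi>\<tt> 1)) - 1)
                   * (\<alpha> (\<pi>\<ss> 1) - \<alpha> (\<pi>\<ss> k) - of_int (n (\<pi>\<ss> k)) + of_int (n (\<pi>\<ss> 1)) + 1))
              * (\<Prod>h = 1..q. (\<alpha> (\<pi>\<ss> k) + \<beta> h + of_int (n (\<pi>\<ss> k)))
                           / (\<alpha> (\<pi>\<ss> k) + \<beta> h + of_int (n (\<pi>\<ss> k)) + of_int (m h)))
              * ((\<Prod>a = 1..p. \<alpha> a - \<alpha> (\<pi>\<ss> k) - of_int (n (\<pi>\<ss> k)))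
                 / (\<Prod>a \<in> {1..p} - {k}. \<alpha> (\<pi>\<ss> a) - \<alpha> (\<pi>\<ss> k) - of_int (n (\<pi>\<ss> k)) + of_int (n (\<pi>\<ss> a)))))))
   \<and> (\<forall>i\<in>{1..p}.
        multi_index p (n - s i) \<and> multi_index q (m - \<tt> i) \<and>
        separated_A p q \<alpha> \<beta> (n - s (i - 1)) (m - \<tt> (i + 1)) \<longrightarrow>
        pairing (A (n - s (i - 1)) (m - \<tt> (i + 1))) (B (n - s i) (m - \<tt> i)) \<noteq> 0 \<and>
        bm i = of_real (
          (\<Prod>h = 1..q. ipoch (\<alpha> (\<pi>s i) + \<beta> h + of_int (n (\<pi>s i))) ((m - \<tt> i) h)
                     / ipoch (\<alpha> (\<pi>s i) + \<beta> h + of_int (n (\<pi>s i))) ((m - \<tt> (i + 1)) h))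
          * (\<Sum>k = i..p.
              (\<Prod>h = 1..q. ipoch (\<alpha> (\<pi>s k) + \<beta> h + of_int (n (\<pi>s k))) ((m - \<tt> (i + 1)) h)
                         / ipoch (\<alpha> (\<pi>s k) + \<beta> h + of_int (n (\<pi>s k)) + 1) (m h))
              * ((\<Prod>a = 1..p. \<alpha> (\<pi>s a) - \<alpha> (\<pi>s k) - of_int (n (\<pi>s k)))
                 / (\<Prod>a \<in> {i..p} - {k}. \<alpha> (\<pi>s a) - \<alpha> (\<pi>s k) - of_int (n (\<pi>s k)) + of_int (n (\<pi>s a)))))))"
proof -
  interpret pineiro_system p q \<alpha> \<beta>
    using alpha_beta alpha_diff beta_diff by unfold_locales (auto simp: nonint_diffs_def)
  have st_s: "step_at p (\<pi>s (l mod p + 1)) (s l) (s (l + 1))" for l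
    unfolding paths by (rule index_path_step[OF perms(1) pq(1)])
  have st_ss: "step_at p (\<pi>\<ss> (l mod p + 1)) (\<ss> l) (\<ss> (l + 1))" for l
    unfolding paths by (rule index_path_step[OF perms(2) pq(1)])
  have st_t: "step_at q (\<pi>t (l mod q + 1)) (t l) (t (l + 1))" for l
    unfolding paths by (rule index_path_step[OF perms(3) pq(2)])
  have st_tt: "step_at q (\<pi>\<tt> (l mod q + 1)) (\<tt> l) (\<tt> (l + 1))" for l
    unfolding paths by (rule index_path_step[OF perms(4) pq(2)])
  have zero: "s 0 = 0" "\<ss> 0 = 0" "t 0 = 0" "\<tt> 0 = 0" unfolding paths by (simp_all add: index_path_0)
  have sums: "(\<Sum>a = 1..p. s l a) = int l" "(\<Sum>a = 1..p. \<ss> l a) = int l"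
    "(\<Sum>a = 1..q. t l a) = int l" "(\<Sum>a = 1..q. \<tt> l a) = int l" for l
    unfolding paths using sum_index_path perms pq by blast+
  have plus_n: "multi_index p (n + \<ss> l)" and plus_m: "multi_index q (m + t l)" for l
    unfolding paths using nm by (auto intro: multi_index_add_path)
  have total_plus: "(\<Sum>j = 1..q. (m + t l) j) = (\<Sum>i = 1..p. (n + \<ss> l) i) + 1" for l
    using nm(3) by (simp add: sum.distrib sums[simplified])
  have total_minus: "(\<Sum>j = 1..q. (m - \<tt> l) j) = (\<Sum>i = 1..p. (n - s l) i) + 1" for l
    using nm(3) by (simp add: sum_subtractf sums[simplified])

  \<comment> \<open>Forward coefficients\<close>
  have P: "pairing (A (n + \<ss> (j + 1)) (m + t (j - 1))) (B (n + \<ss> j) (m + t j)) \<noteq> 0 \<and>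
        bp j = of_real (
          (\<Prod>a = 1..p. ipoch (\<alpha> a + \<beta> (\<pi>t j) + of_int (m (\<pi>t j)) + 1) ((n + \<ss> (j + 1)) a)
                     / ipoch (\<alpha> a + \<beta> (\<pi>t j) + of_int (m (\<pi>t j)) + 1) ((n + \<ss> j) a))
          * (\<Sum>k = j..q.
              (\<Prod>a = 1..p. ipoch (\<alpha> a + \<beta> (\<pi>t k) + of_int (m (\<pi>t k))) (n a)
                         / ipoch (\<alpha> a + \<beta> (\<pi>t k) + of_int (m (\<pi>t k)) + 1) ((n + \<ss> (j + 1)) a))
              * ((\<Prod>h = 1..q. \<beta> (\<pi>t h) - \<beta> (\<pi>t k) - of_int (m (\<pi>t k)))
                 / (\<Prod>h \<in> {j..q} - {k}. \<beta> (\<pi>t h) - \<beta> (\<pi>t k) - of_int (m (\<pi>t k)) + of_int (m (\<pi>t h))))))"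
    if j: "j \<in> {1..q}" for j
  proof -
    define u u' v v' where "u = n + \<ss> j" and "u' = n + \<ss> (j + 1)" and "v = m + t (j - 1)" and "v' = m + t j"
    define a b where "a = \<pi>\<ss> (j mod p + 1)" and "b = \<pi>t j"
    have st: "step_at p a u u'" unfolding u_def u'_def a_def by (intro step_at_add st_ss)
    have "(j - 1) mod q + 1 = j" "j - 1 + 1 = j" using j by auto
    then have st': "step_at q b v v'" unfolding v_def v'_def b_def using step_at_add[OF st_t[of "j - 1"]] by simp
    have mi: "multi_index p u" "multi_index p u'" "multi_index q v" "multi_index q v'"
      unfolding u_def u'_def v_def v'_def by (rule plus_n plus_m)+
    have tot: "(\<Sum>j = 1..q. v' j) = (\<Sum>i = 1..p. u i) + 1" unfolding u_def v'_def by (rule total_plus)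
    have tot': "(\<Sum>i = 1..p. u' i) = (\<Sum>j = 1..q. v j) + 1"
      using tot step_at_sum[OF st] step_at_sum[OF st'] by simp
    note pd = pairing_dual[OF st st' mi(1,4) sepA_nonneg[OF mi(3)] tot]
    have b: "b \<in> {1..q}" using st' by (simp add: step_at_def)
    \<comment> \<open>Row \<open>\<pi>t j\<close> is first visited in step \<open>j\<close>, so
      \<open>v\<close> still agrees with \<open>m\<close> there and the pairing can be expressed by
      \<open>y\<close>.\<close>
    have "index_path q \<pi>t (j - 1) (\<pi>t j) = 0" using index_path_permuted[OF perms(3) j, of "j - 1"] j by auto
    then have vb: "v b = m b" by (simp add: v_def b_def paths)
    define y where "y = \<beta> b + of_int (m b)"
    have mb: "0 \<le> m b" using nm b by (auto simp: multi_index_def)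
    have ypos: "y + \<alpha> i + 1 > 0" if "i \<in> {1..p}" for i
      using alpha_beta[OF that b] mb by (simp add: y_def)
    \<comment> \<open>The two indices are consecutive, so the quotient collapses to one factor, the
      reciprocal of the pairing.\<close>
    have pre: "(\<Prod>a = 1..p. ipoch (\<alpha> a + \<beta> (\<pi>t j) + of_int (m (\<pi>t j)) + 1) (u' a)
                     / ipoch (\<alpha> a + \<beta> (\<pi>t j) + of_int (m (\<pi>t j)) + 1) (u a)) = y + \<alpha> a + 1 + of_int (u a)"
    proof -
      have "pprod p \<alpha> u y > 0" by (rule pprod_pos[OF mi(1) ypos])
      moreover have "0 \<le> u a" using mi st by (auto simp: multi_index_def step_at_def)
      then have "pprod p \<alpha> u' y = pprod p \<alpha> u y * (y + \<alpha> a + 1 + of_int (u a))"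
        using pprod_step[OF st] by blast
      ultimately have "pprod p \<alpha> u' y / pprod p \<alpha> u y = y + \<alpha> a + 1 + of_int (u a)" by simp
      then show ?thesis unfolding prod_dividef pprod_def by (simp add: y_def b_def algebra_simps)
    qed
    have pair: "pairing (A u' v) (B u v') = of_real (1 / (y + \<alpha> a + 1 + of_int (u a)))"
      and ne: "y + \<alpha> a + 1 + of_int (u a) \<noteq> 0"
      using pd(1,3,4) unfolding forms vb y_def by (simp_all add: algebra_simps)
    define K where "K = {k \<in> {1..q}. v k = m k}"
    have K: "K = \<pi>t ` {j..q}"
      using permuted_slice[OF perms(3) j] by (simp add: K_def v_def paths)
    have vm: "v h = m h \<or> v h = m h + 1" if "h \<in> {1..q}" for h
      using index_path_0_or_1[OF perms(3) _ that, of "j - 1"] j by (auto simp: v_def paths)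
    have inj: "inj \<pi>t" by (rule permutes_inj[OF perms(3)])
    have "xpairing (A u' v) (B n m) = of_real (\<Sum>k\<in>K.
     pprod p \<alpha> n (\<beta> k + of_int (m k) - 1) / pprod p \<alpha> u' (\<beta> k + of_int (m k)) *
     ((\<Prod>h = 1..q. \<beta> h - \<beta> k - of_int (m k)) / (\<Prod>h\<in>K - {k}. \<beta> h - \<beta> k - of_int (m k) + of_int (m h))))"
      unfolding forms by (rule xpairing_beta_sum[OF nm mi(2,3) tot' vm K_def])
    also have "(\<Sum>k\<in>K.
     pprod p \<alpha> n (\<beta> k + of_int (m k) - 1) / pprod p \<alpha> u' (\<beta> k + of_int (m k)) *
     ((\<Prod>h = 1..q. \<beta> h - \<beta> k - of_int (m k)) / (\<Prod>h\<in>K - {k}. \<beta> h - \<beta> k - of_int (m k) + of_int (m h)))) =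
      (\<Sum>k = j..q.
              (\<Prod>a = 1..p. ipoch (\<alpha> a + \<beta> (\<pi>t k) + of_int (m (\<pi>t k))) (n a)
                         / ipoch (\<alpha> a + \<beta> (\<pi>t k) + of_int (m (\<pi>t k)) + 1) (u' a))
              * ((\<Prod>h = 1..q. \<beta> (\<pi>t h) - \<beta> (\<pi>t k) - of_int (m (\<pi>t k)))
                 / (\<Prod>h \<in> {j..q} - {k}. \<beta> (\<pi>t h) - \<beta> (\<pi>t k) - of_int (m (\<pi>t k)) + of_int (m (\<pi>t h)))))"
      unfolding K sum.reindex[OF inj_on_subset[OF inj subset_UNIV]] o_def
    proof (rule sum.cong[OF refl])
      fix k assume "k \<in> {j..q}"
      have "(\<Prod>h = 1..q. \<beta> h - \<beta> (\<pi>t k) - of_int (m (\<pi>t k))) =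
          (\<Prod>h = 1..q. \<beta> (\<pi>t h) - \<beta> (\<pi>t k) - of_int (m (\<pi>t k)))"
        by (subst prod.permute[OF perms(3)]) (simp add: o_def)
      moreover have "pprod p \<alpha> n (\<beta> (\<pi>t k) + of_int (m (\<pi>t k)) - 1) / pprod p \<alpha> u' (\<beta> (\<pi>t k) + of_int (m (\<pi>t k))) =
         (\<Prod>a = 1..p. ipoch (\<alpha> a + \<beta> (\<pi>t k) + of_int (m (\<pi>t k))) (n a)
                         / ipoch (\<alpha> a + \<beta> (\<pi>t k) + of_int (m (\<pi>t k)) + 1) (u' a))"
        unfolding pprod_def prod_dividef by (simp add: algebra_simps)
      ultimately show "pprod p \<alpha> n (\<beta> (\<pi>t k) + of_int (m (\<pi>t k)) - 1) / pprod p \<alpha> u' (\<beta> (\<pi>t k) + of_int (m (\<pi>t k))) *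
          ((\<Prod>h = 1..q. \<beta> h - \<beta> (\<pi>t k) - of_int (m (\<pi>t k))) /
           (\<Prod>h\<in>\<pi>t ` {j..q} - {\<pi>t k}. \<beta> h - \<beta> (\<pi>t k) - of_int (m (\<pi>t k)) + of_int (m h))) =
         (\<Prod>a = 1..p. ipoch (\<alpha> a + \<beta> (\<pi>t k) + of_int (m (\<pi>t k))) (n a)
                         / ipoch (\<alpha> a + \<beta> (\<pi>t k) + of_int (m (\<pi>t k)) + 1) (u' a))
              * ((\<Prod>h = 1..q. \<beta> (\<pi>t h) - \<beta> (\<pi>t k) - of_int (m (\<pi>t k)))
                 / (\<Prod>h \<in> {j..q} - {k}. \<beta> (\<pi>t h) - \<beta> (\<pi>t k) - of_int (m (\<pi>t k)) + of_int (m (\<pi>t h))))"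
        unfolding prod_image_remove[OF inj] by simp
    qed
    finally have xp: "xpairing (A u' v) (B n m) = of_real (\<Sum>k = j..q.
              (\<Prod>a = 1..p. ipoch (\<alpha> a + \<beta> (\<pi>t k) + of_int (m (\<pi>t k))) (n a)
                         / ipoch (\<alpha> a + \<beta> (\<pi>t k) + of_int (m (\<pi>t k)) + 1) (u' a))
              * ((\<Prod>h = 1..q. \<beta> (\<pi>t h) - \<beta> (\<pi>t k) - of_int (m (\<pi>t k)))
                 / (\<Prod>h \<in> {j..q} - {k}. \<beta> (\<pi>t h) - \<beta> (\<pi>t k) - of_int (m (\<pi>t k)) + of_int (m (\<pi>t h)))))"
      (is "_ = of_real ?S") .
    have "bp j = of_real ?S / of_real (1 / (y + \<alpha> a + 1 + of_int (u a)))"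
      unfolding bp u_def[symmetric] u'_def[symmetric] v_def[symmetric] v'_def[symmetric] xp pair ..
    then have "bp j = of_real ((y + \<alpha> a + 1 + of_int (u a)) * ?S)"
      unfolding of_real_divide[symmetric] by (simp only: divide_divide_eq_right div_by_1 mult.commute)
    moreover have "pairing (A u' v) (B u v') \<noteq> 0" unfolding pair of_real_eq_0_iff using ne by simp
    ultimately show ?thesis
      unfolding u_def[symmetric] u'_def[symmetric] v_def[symmetric] v'_def[symmetric] pre by blast
  qed

  \<comment> \<open>Middle coefficient\<close>
  have Z: "pairing (A (n + \<ss> 1) (m - \<tt> 1)) (B n m) \<noteq> 0 \<and>
        b0 = of_real (
          (\<Prod>h = 1..q. (\<alpha> (\<pi>\<ss> 1) + \<beta> h + of_int (n (\<pi>\<ss> 1)) + 1)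
                     / (\<alpha> (\<pi>\<ss> 1) + \<beta> h + of_int (n (\<pi>\<ss> 1)) + of_int (m h) + 1))
          * (\<Prod>a = 1..p. (\<alpha> a - \<alpha> (\<pi>\<ss> 1) - of_int (n (\<pi>\<ss> 1)) - 1)
                       / (\<alpha> a - \<alpha> (\<pi>\<ss> 1) - of_int (n (\<pi>\<ss> 1)) + of_int (n a) - 1))
          + (\<Sum>k = 1..p.
              (\<alpha> (\<pi>\<ss> 1) + \<beta> (\<pi>\<tt> 1) + of_int (n (\<pi>\<ss> 1)) + of_int (m (\<pi>\<tt> 1)))
                / ((\<alpha> (\<pi>\<ss> k) + \<beta> (\<pi>\<tt> 1) + of_int (n (\<pi>\<ss> k)) + of_int (m (\<pi>\<tt> 1)) - 1)
                   * (\<alpha> (\<pi>\<ss> 1) - \<alpha> (\<pi>\<ss> k) - of_int (n (\<pi>\<ss> k)) + of_int (n (\<pi>\<ss> 1)) + 1))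
              * (\<Prod>h = 1..q. (\<alpha> (\<pi>\<ss> k) + \<beta> h + of_int (n (\<pi>\<ss> k)))
                           / (\<alpha> (\<pi>\<ss> k) + \<beta> h + of_int (n (\<pi>\<ss> k)) + of_int (m h)))
              * ((\<Prod>a = 1..p. \<alpha> a - \<alpha> (\<pi>\<ss> k) - of_int (n (\<pi>\<ss> k)))
                 / (\<Prod>a \<in> {1..p} - {k}. \<alpha> (\<pi>\<ss> a) - \<alpha> (\<pi>\<ss> k) - of_int (n (\<pi>\<ss> k)) + of_int (n (\<pi>\<ss> a))))))"
    if sep: "separated_A p q \<alpha> \<beta> (n + \<ss> 1) (m - \<tt> 1)"
  proof -
    have st: "step_at p (\<pi>\<ss> 1) n (n + \<ss> 1)" using step_at_add[OF st_ss[of 0], of n] by (simp add: zero)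
    have st': "step_at q (\<pi>\<tt> 1) (m - \<tt> 1) m" using step_at_diff[OF st_tt[of 0], of m] by (simp add: zero)
    note dc = diagonal_coeff[OF nm st st' sep]
    have inj: "inj \<pi>\<ss>" by (rule permutes_inj[OF perms(2)])
    \<comment> \<open>The claimed formula enumerates the rows through \<open>\<pi>\<ss>\<close>;
      sums and products over all rows are reordered accordingly.\<close>
    have rem: "(\<Prod>a\<in>{1..p} - {\<pi>\<ss> k}. f a) = (\<Prod>a\<in>{1..p} - {k}. f (\<pi>\<ss> a))" for k and f :: "nat \<Rightarrow> real"
      using prod_image_remove[OF inj, of f "{1..p}" k] unfolding permutes_image[OF perms(2)] .
    have sp: "(\<Sum>k = 1..p. f k) = (\<Sum>k = 1..p. f (\<pi>\<ss> k))" for f :: "nat \<Rightarrow> real"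
      by (subst sum.permute[OF perms(2)]) (simp add: o_def)
    show ?thesis
      unfolding b0 forms dc(2)
      using dc(1)
      by (subst sp) (simp only: rem simp_thms)
  qed

  \<comment> \<open>Backward coefficients\<close>
  have M: "pairing (A (n - s (i - 1)) (m - \<tt> (i + 1))) (B (n - s i) (m - \<tt> i)) \<noteq> 0 \<and>
        bm i = of_real (
          (\<Prod>h = 1..q. ipoch (\<alpha> (\<pi>s i) + \<beta> h + of_int (n (\<pi>s i))) ((m - \<tt> i) h)
                     / ipoch (\<alpha> (\<pi>s i) + \<beta> h + of_int (n (\<pi>s i))) ((m - \<tt> (i + 1)) h))
          * (\<Sum>k = i..p.
              (\<Prod>h = 1..q. ipoch (\<alpha> (\<pi>s k) + \<beta> h + of_int (n (\<pi>s k))) ((m - \<tt> (i + 1)) h)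
                         / ipoch (\<alpha> (\<pi>s k) + \<beta> h + of_int (n (\<pi>s k)) + 1) (m h))
              * ((\<Prod>a = 1..p. \<alpha> (\<pi>s a) - \<alpha> (\<pi>s k) - of_int (n (\<pi>s k)))
                 / (\<Prod>a \<in> {i..p} - {k}. \<alpha> (\<pi>s a) - \<alpha> (\<pi>s k) - of_int (n (\<pi>s k)) + of_int (n (\<pi>s a))))))"
    if i: "i \<in> {1..p}" and u: "multi_index p (n - s i)" and v': "multi_index q (m - \<tt> i)"
      and sep: "separated_A p q \<alpha> \<beta> (n - s (i - 1)) (m - \<tt> (i + 1))" for i
  proof -
    define u u' v v' where "u = n - s i" and "u' = n - s (i - 1)" and "v = m - \<tt> (i + 1)" and "v' = m - \<tt> i"
    note defs = u_def[symmetric] u'_def[symmetric] v_def[symmetric] v'_def[symmetric]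
    define a b where "a = \<pi>s i" and "b = \<pi>\<tt> (i mod q + 1)"
    have "(i - 1) mod p + 1 = i" "i - 1 + 1 = i" using i by auto
    then have st: "step_at p a u u'" unfolding u_def u'_def a_def using step_at_diff[OF st_s[of "i - 1"]] by simp
    have st': "step_at q b v v'" unfolding v_def v'_def b_def by (intro step_at_diff st_tt)
    have mi: "multi_index p u" "multi_index q v'" using u v' by (auto simp: u_def v'_def)
    then have mi': "multi_index p u'" using step_at_le[OF st] by (force simp: multi_index_def)
    have tot: "(\<Sum>j = 1..q. v' j) = (\<Sum>i = 1..p. u i) + 1" unfolding u_def v'_def by (rule total_minus)
    have sep': "separated_A p q \<alpha> \<beta> u' v" using sep by (simp add: u'_def v_def)
    note pd = pairing_dual[OF st st' mi sep' tot]
    \<comment> \<open>Row \<open>\<pi>s i\<close> is lowered by exactly one, so the new node of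
      \<open>u'\<close> is \<open>\<alpha> a + n a - 1\<close>; the 1 inside \<open>pprod\<close>
      then gives the arguments \<open>\<alpha> a + \<beta> h + n a\<close> of the prefactor.\<close>
    have "index_path p \<pi>s i (\<pi>s i) = 1" using index_path_permuted[OF perms(1) i, of i] i by auto
    then have ua: "u a = n a - 1" by (simp add: u_def a_def paths)
    define R where "R = pprod q \<beta> v' (\<alpha> a + of_int (u a)) / pprod q \<beta> v (\<alpha> a + of_int (u a))"
    have pair: "pairing (A u' v) (B u v') = of_real (1 / R)"
      using pd(1) by (simp add: forms R_def)
    have ne: "R \<noteq> 0"
    proof -
      have "1 / R \<noteq> 0" using pd(3,4) by (simp add: R_def)
      then show ?thesis by auto
    qed
    have pre: "(\<Prod>h = 1..q. ipoch (\<alpha> (\<pi>s i) + \<beta> h + of_int (n (\<pi>s i))) (v' h)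
                     / ipoch (\<alpha> (\<pi>s i) + \<beta> h + of_int (n (\<pi>s i))) (v h)) = R"
      unfolding R_def pprod_def prod_dividef ua by (simp add: a_def algebra_simps)
    define K where "K = {k \<in> {1..p}. n k = u' k}"
    have K: "K = \<pi>s ` {i..p}"
      using permuted_slice[OF perms(1) i] by (simp add: K_def u'_def paths)
    have nu: "n h = u' h \<or> n h = u' h + 1" if "h \<in> {1..p}" for h
      using index_path_0_or_1[OF perms(1) _ that, of "i - 1"] i by (auto simp: u'_def paths)
    have inj: "inj \<pi>s" by (rule permutes_inj[OF perms(1)])
    have "xpairing (A u' v) (B n m) = of_real (\<Sum>k\<in>K.
     pprod q \<beta> v (\<alpha> k + of_int (n k) - 1) / pprod q \<beta> m (\<alpha> k + of_int (n k)) *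
     ((\<Prod>h = 1..p. \<alpha> h - \<alpha> k - of_int (n k)) / (\<Prod>h\<in>K - {k}. \<alpha> h - \<alpha> k - of_int (n k) + of_int (n h))))"
      unfolding forms by (rule xpairing_alpha_sum[OF nm mi' sep' nu K_def])
    also have "(\<Sum>k\<in>K.
     pprod q \<beta> v (\<alpha> k + of_int (n k) - 1) / pprod q \<beta> m (\<alpha> k + of_int (n k)) *
     ((\<Prod>h = 1..p. \<alpha> h - \<alpha> k - of_int (n k)) / (\<Prod>h\<in>K - {k}. \<alpha> h - \<alpha> k - of_int (n k) + of_int (n h)))) =
      (\<Sum>k = i..p.
              (\<Prod>h = 1..q. ipoch (\<alpha> (\<pi>s k) + \<beta> h + of_int (n (\<pi>s k))) (v h)
                         / ipoch (\<alpha> (\<pi>s k) + \<beta> h + of_int (n (\<pi>s k)) + 1) (m h))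
              * ((\<Prod>a = 1..p. \<alpha> (\<pi>s a) - \<alpha> (\<pi>s k) - of_int (n (\<pi>s k)))
                 / (\<Prod>a \<in> {i..p} - {k}. \<alpha> (\<pi>s a) - \<alpha> (\<pi>s k) - of_int (n (\<pi>s k)) + of_int (n (\<pi>s a)))))"
      unfolding K sum.reindex[OF inj_on_subset[OF inj subset_UNIV]] o_def
    proof (rule sum.cong[OF refl])
      fix k assume "k \<in> {i..p}"
      have "(\<Prod>h = 1..p. \<alpha> h - \<alpha> (\<pi>s k) - of_int (n (\<pi>s k))) =
          (\<Prod>h = 1..p. \<alpha> (\<pi>s h) - \<alpha> (\<pi>s k) - of_int (n (\<pi>s k)))"
        by (subst prod.permute[OF perms(1)]) (simp add: o_def)
      moreover have "pprod q \<beta> v (\<alpha> (\<pi>s k) + of_int (n (\<pi>s k)) - 1) / pprod q \<beta> m (\<alpha> (\<pi>s k) + of_int (n (\<pi>s k))) =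
         (\<Prod>h = 1..q. ipoch (\<alpha> (\<pi>s k) + \<beta> h + of_int (n (\<pi>s k))) (v h)
                         / ipoch (\<alpha> (\<pi>s k) + \<beta> h + of_int (n (\<pi>s k)) + 1) (m h))"
        unfolding pprod_def prod_dividef by (simp add: algebra_simps)
      ultimately show "pprod q \<beta> v (\<alpha> (\<pi>s k) + of_int (n (\<pi>s k)) - 1) / pprod q \<beta> m (\<alpha> (\<pi>s k) + of_int (n (\<pi>s k))) *
          ((\<Prod>h = 1..p. \<alpha> h - \<alpha> (\<pi>s k) - of_int (n (\<pi>s k))) /
           (\<Prod>h\<in>\<pi>s ` {i..p} - {\<pi>s k}. \<alpha> h - \<alpha> (\<pi>s k) - of_int (n (\<pi>s k)) + of_int (n h))) =
         (\<Prod>h = 1..q. ipoch (\<alpha> (\<pi>s k) + \<beta> h + of_int (n (\<pi>s k))) (v h)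
                         / ipoch (\<alpha> (\<pi>s k) + \<beta> h + of_int (n (\<pi>s k)) + 1) (m h))
              * ((\<Prod>a = 1..p. \<alpha> (\<pi>s a) - \<alpha> (\<pi>s k) - of_int (n (\<pi>s k)))
                 / (\<Prod>a \<in> {i..p} - {k}. \<alpha> (\<pi>s a) - \<alpha> (\<pi>s k) - of_int (n (\<pi>s k)) + of_int (n (\<pi>s a))))"
        unfolding prod_image_remove[OF inj] by simp
    qed
    finally have xp: "xpairing (A u' v) (B n m) = of_real (\<Sum>k = i..p.
              (\<Prod>h = 1..q. ipoch (\<alpha> (\<pi>s k) + \<beta> h + of_int (n (\<pi>s k))) (v h)
                         / ipoch (\<alpha> (\<pi>s k) + \<beta> h + of_int (n (\<pi>s k)) + 1) (m h))
              * ((\<Prod>a = 1..p. \<alpha> (\<pi>s a) - \<alpha> (\<pi>s k) - of_int (n (\<pi>s k)))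
                 / (\<Prod>a \<in> {i..p} - {k}. \<alpha> (\<pi>s a) - \<alpha> (\<pi>s k) - of_int (n (\<pi>s k)) + of_int (n (\<pi>s a)))))"
      (is "_ = of_real ?S") .
    have "bm i = of_real ?S / of_real (1 / R)" unfolding bm defs xp pair ..
    then have "bm i = of_real (R * ?S)"
      unfolding of_real_divide[symmetric] by (simp only: divide_divide_eq_right div_by_1 mult.commute)
    moreover have "pairing (A u' v) (B u v') \<noteq> 0" unfolding pair of_real_eq_0_iff using ne by simp
    ultimately show ?thesis unfolding defs pre by blast
  qed

  \<comment> \<open>The recurrence relation along the glued chain\<close>
  have Rec: "of_real x * B n m x =
            (\<Sum>j = 1..q. bp j * B (n + \<ss> j) (m + t j) x) + b0 * B n m x
            + (\<Sum>i \<in> {i \<in> {1..p}. multi_index p (n - s i) \<and> multi_index q (m - \<tt> i)}.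
                 bm i * B (n - s i) (m - \<tt> i) x)"
    if sep0: "separated_A p q \<alpha> \<beta> (n + \<ss> 1) (m - \<tt> 1)"
      and sepi: "\<forall>i\<in>{1..p}. if multi_index p (n - s i) \<and> multi_index q (m - \<tt> i)
                 then separated_A p q \<alpha> \<beta> (n - s (i - 1)) (m - \<tt> (i + 1))
                 else n (\<pi>s i) = 0"
      and x: "x \<in> {0<..<1}" for x
  proof -
    define V where "V = {i \<in> {1..p}. multi_index p (n - s i) \<and> multi_index q (m - \<tt> i)}"
    \<comment> \<open>Index paths increase, so if \<open>r\<close> is admissible then so is every
      smaller positive index; \<open>r = 0\<close> means that all backward terms are absent.\<close>
    define r where "r = Max (insert 0 V)"
    have V: "V = {1..r}"
    proof (intro equalityI subsetI)
      fix i assume "i \<in> V"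
      then show "i \<in> {1..r}" unfolding r_def by (auto simp: V_def)
    next
      fix i assume i: "i \<in> {1..r}"
      have "r \<in> insert 0 V" unfolding r_def by (rule Max_in) (auto simp: V_def)
      with i have r: "r \<in> V" by auto
      have rN: "multi_index p (n - s r)" and rM: "multi_index q (m - \<tt> r)" and rp: "r \<le> p"
        using r by (auto simp: V_def)
      have "multi_index p (n - s i)"
        unfolding multi_index_def
      proof
        fix a assume a: "a \<in> {1..p}"
        have "s i a \<le> s r a"
          unfolding paths by (rule index_path_mono[OF perms(1) pq(1) _ a]) (use i in auto)
        moreover have "0 \<le> (n - s r) a" using rN a by (simp only: multi_index_def)
        ultimately show "0 \<le> (n - s i) a" by simp
      qed
      moreover have "multi_index q (m - \<tt> i)"
        unfolding multi_index_def
      proof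
        fix a assume a: "a \<in> {1..q}"
        have "\<tt> i a \<le> \<tt> r a"
          unfolding paths by (rule index_path_mono[OF perms(4) pq(2) _ a]) (use i in auto)
        moreover have "0 \<le> (m - \<tt> r) a" using rM a by (simp only: multi_index_def)
        ultimately show "0 \<le> (m - \<tt> i) a" by simp
      qed
      moreover have "i \<in> {1..p}" using i rp by auto
      ultimately show "i \<in> V" by (simp only: V_def mem_Collect_eq simp_thms)
    qed
    \<comment> \<open>The forward and backward paths are glued at 0. The backward ones are run in
      reverse, so that every step of the chain increases, and the dual indices
      \<open>N (l + 1)\<close> and \<open>M (l - 1)\<close> become those in \<open>bp\<close>,
      \<open>b0\<close> and \<open>bm\<close>.\<close>
    define N where "N = (\<lambda>l::int. if 0 \<le> l then n + \<ss> (nat l) else n - s (nat (- l)))"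
    define M where "M = (\<lambda>l::int. if 0 \<le> l then m + t (nat l) else m - \<tt> (nat (- l)))"
    define c where "c = (\<lambda>l::int. if 0 < l then bp (nat l) else if l = 0 then b0 else bm (nat (- l)))"
    have Nn: "N (- int k) = n - s k" and Mn: "M (- int k) = m - \<tt> k" for k
      by (cases "k = 0"; simp add: N_def M_def zero)+
    have Np: "N (int k) = n + \<ss> k" and Mp: "M (int k) = m + t k" for k
      by (simp_all add: N_def M_def)
    have N0: "N 0 = n" and M0: "M 0 = m" by (simp_all add: N_def M_def zero)
    have "of_real x * B (N 0) (M 0) x = (\<Sum>l\<in>{- int r..int q}. c l * B (N l) (M l) x)"
      unfolding forms
    proof (rule chain_recurrence)
      fix l :: int
      show "\<exists>a. step_at p a (N l) (N (l + 1))"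
      proof (cases "0 \<le> l")
        case True
        then obtain k where k: "l = int k" by (metis nonneg_int_cases)
        have "N (l + 1) = n + \<ss> (k + 1)" using Np[of "k + 1"] by (simp add: k add.commute)
        then show ?thesis using step_at_add[OF st_ss[of k], of n] Np[of k] k by auto
      next
        case False
        define k where "k = nat (- l - 1)"
        have "l = - int (k + 1)" "l + 1 = - int k" using False by (simp_all add: k_def)
        then show ?thesis using step_at_diff[OF st_s[of k], of n] Nn by metis
      qed
      show "\<exists>b. step_at q b (M (l - 1)) (M l)"
      proof (cases "0 < l")
        case True
        define k where "k = nat (l - 1)"
        have "l = int (k + 1)" "l - 1 = int k" using True by (simp_all add: k_def)
        then show ?thesis using step_at_add[OF st_t[of k], of m] Mp by metis
      next
        case False
        define k where "k = nat (- l)"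
        have "l = - int k" "l - 1 = - int (k + 1)" using False by (simp_all add: k_def)
        then show ?thesis using step_at_diff[OF st_tt[of k], of m] Mn by metis
      qed
    next
      show "multi_index p (N (- int r))" "multi_index q (M (- int r))"
        unfolding Nn Mn using V nm zero by (cases "r = 0"; force simp: V_def)+
      show "(\<Sum>j = 1..q. M 0 j) = (\<Sum>i = 1..p. N 0 i) + 1" unfolding N0 M0 by (rule nm(3))
      \<comment> \<open>The lowest level is the middle term if there is no backward term, and the
        last admissible backward term otherwise.\<close>
      show "separated_A p q \<alpha> \<beta> (N (- int r + 1)) (M (- int r - 1))"
      proof (cases "r = 0")
        case True
        then show ?thesis using sep0 Np[of 1] Mn[of 1] by simp
      next
        case False
        then have r: "r \<in> V" using V by simp
        have "- int r + 1 = - int (r - 1)" "- int r - 1 = - int (r + 1)" using False by auto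
        then show ?thesis using r sepi unfolding V_def by (metis (no_types, lifting) Mn Nn mem_Collect_eq)
      qed
    next
      fix i assume i: "i \<in> {1..p}" and pos: "0 < N (- int r) i"
      obtain k where k: "k \<in> {1..p}" "i = \<pi>s k"
        using permutes_image[OF perms(1)] i by (metis imageE)
      have "r \<le> p"
      proof (cases "r = 0")
        case False
        then have "r \<in> V" using V by simp
        then show ?thesis by (simp add: V_def)
      qed simp
      then have sr: "s r i = (if k \<le> r then 1 else 0)"
        unfolding paths k(2) by (rule index_path_permuted[OF perms(1) k(1)])
      \<comment> \<open>A row not lowered by the first \<open>r\<close> backward steps belongs to an
        absent term; the hypothesis makes it empty, contrary to \<open>pos\<close>.\<close>
      have "k \<le> r"
      proof (rule ccontr)
        assume "\<not> k \<le> r"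
        then have "k \<notin> V" using V by simp
        then have "\<not> (multi_index p (n - s k) \<and> multi_index q (m - \<tt> k))"
          using k(1) by (simp only: V_def mem_Collect_eq simp_thms)
        with bspec[OF sepi k(1)] have "n i = 0" unfolding k(2) by (simp only: if_False)
        with pos sr \<open>\<not> k \<le> r\<close> show False by (simp add: Nn)
      qed
      then show "N (- int r) i < N 0 i" using sr by (simp add: Nn N0)
    next
      fix j assume j: "j \<in> {1..q}"
      obtain k where k: "k \<in> {1..q}" "j = \<pi>t k"
        using permutes_image[OF perms(3)] j by (metis imageE)
      \<comment> \<open>After \<open>q\<close> steps the path is the all-ones vector, so the forward
        terms reach just far enough to contain all shifted exponents.\<close>
      have "t q j = 1" unfolding paths k(2) using index_path_permuted[OF perms(3) k(1), of q] k by simp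
      then show "M 0 j < M (int q) j" by (simp add: Mp M0)
    next
      fix l :: int
      show "c l = xpairing (pineiro_A p q \<alpha> \<beta> (N (l + 1)) (M (l - 1))) (pineiro_B p q \<alpha> \<beta> (N 0) (M 0)) /
           pairing (pineiro_A p q \<alpha> \<beta> (N (l + 1)) (M (l - 1))) (pineiro_B p q \<alpha> \<beta> (N l) (M l))"
        unfolding forms[symmetric]
      proof (cases l "0 :: int" rule: linorder_cases)
        case greater
        define j where "j = nat l"
        have "l = int j" "l + 1 = int (j + 1)" "l - 1 = int (j - 1)" using greater by (auto simp: j_def)
        moreover have "c l = bp j" using greater by (simp add: c_def j_def)
        ultimately show "c l = xpairing (A (N (l + 1)) (M (l - 1))) (B (N 0) (M 0)) /
           pairing (A (N (l + 1)) (M (l - 1))) (B (N l) (M l))"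
          by (simp only: bp Np Mp N0 M0)
      next
        case equal
        then show "c l = xpairing (A (N (l + 1)) (M (l - 1))) (B (N 0) (M 0)) /
           pairing (A (N (l + 1)) (M (l - 1))) (B (N l) (M l))"
          using Np[of 1] Mn[of 1] by (simp add: c_def b0 N0 M0)
      next
        case less
        define i where "i = nat (- l)"
        have "l = - int i" "l + 1 = - int (i - 1)" "l - 1 = - int (i + 1)" using less by (auto simp: i_def)
        moreover have "c l = bm i" using less by (simp add: c_def i_def)
        ultimately show "c l = xpairing (A (N (l + 1)) (M (l - 1))) (B (N 0) (M 0)) /
           pairing (A (N (l + 1)) (M (l - 1))) (B (N l) (M l))"
          by (simp only: bm Nn Mn N0 M0)
      qed
    qed (use x in auto)
    also have "(\<Sum>l\<in>{- int r..int q}. c l * B (N l) (M l) x) =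
       (\<Sum>l\<in>int ` {1..q} \<union> {0} \<union> (\<lambda>i. - int i) ` {1..r}. c l * B (N l) (M l) x)"
    proof (rule sum.cong[OF _ refl], intro equalityI subsetI)
      fix l assume l: "l \<in> {- int r..int q}"
      consider "0 < l" | "l = 0" | "l < 0" by linarith
      then show "l \<in> int ` {1..q} \<union> {0} \<union> (\<lambda>i. - int i) ` {1..r}"
      proof cases
        case 1
        then have "l \<in> int ` {1..q}" using l by (intro image_eqI[of _ _ "nat l"]) auto
        then show ?thesis by blast
      next
        case 3
        then have "l \<in> (\<lambda>i. - int i) ` {1..r}" using l by (intro image_eqI[of _ _ "nat (- l)"]) auto
        then show ?thesis by blast
      qed auto
    qed auto
    also have "\<dots> = (\<Sum>l\<in>int ` {1..q}. c l * B (N l) (M l) x) + c 0 * B (N 0) (M 0) x +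
        (\<Sum>l\<in>(\<lambda>i. - int i) ` {1..r}. c l * B (N l) (M l) x)"
      by (subst sum.union_disjoint; (subst sum.union_disjoint)?; force)
    also have "(\<Sum>l\<in>int ` {1..q}. c l * B (N l) (M l) x) = (\<Sum>j = 1..q. bp j * B (n + \<ss> j) (m + t j) x)"
      by (subst sum.reindex) (auto simp: Np Mp c_def intro!: sum.cong)
    also have "(\<Sum>l\<in>(\<lambda>i. - int i) ` {1..r}. c l * B (N l) (M l) x) = (\<Sum>i\<in>V. bm i * B (n - s i) (m - \<tt> i) x)"
      unfolding V by (subst sum.reindex) (auto simp: inj_on_def Nn Mn c_def intro!: sum.cong)
    finally have "of_real x * B (N 0) (M 0) x = (\<Sum>j = 1..q. bp j * B (n + \<ss> j) (m + t j) x) +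
        c 0 * B (N 0) (M 0) x + (\<Sum>i\<in>V. bm i * B (n - s i) (m - \<tt> i) x)" .
    moreover have "c 0 = b0" by (simp add: c_def)
    ultimately show ?thesis unfolding N0 M0 V_def by (simp only:)
  qed

  show ?thesis
    using Rec P Z M by blast
qed

end
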